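(* For every prime power $q$, Homma's constant satisfies $D(q) \le q-1$.
   Context: Let $q$ be a prime power and $\mathbb{F}_q$ the finite field with $q$ elements. For a positive integer $d$, let $M_q(d)$ denote the maximum of $|\mathcal{X}(\mathbb{F}_q)|$ (the number of $\mathbb{F}_q$-rational points) taken over all irreducible projective curves $\mathcal{X}$ of degree $d$ defined over $\mathbb{F}_q$ lying in a projective space $\mathbb{P}^n$ over $\mathbb{F}_q$ of any dimension $n$ (the dimension is not fixed; the curves need not be nonsingular). Homma's constant is $D(q) := \limsup_{d\to\infty} M_q(d)/d$. *)

theory Defs
  imports "HOL-Analysis.Analysis" "HOL-Library.Poly_Mapping"
begin

text \<open>Multivariate polynomials over a field, as finitely supported maps from
  monomials (exponent vectors, finitely supported maps nat to nat) to coefficients.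
  The variable with index i is x_i; a polynomial in the homogeneous coordinates
  of P^n uses only the variables x_0, ..., x_n.\<close>

type_synonym 'a mpoly = "(nat \<Rightarrow>\<^sub>0 nat) \<Rightarrow>\<^sub>0 'a"

definition mdeg :: "(nat \<Rightarrow>\<^sub>0 nat) \<Rightarrow> nat" where
  "mdeg \<alpha> = (\<Sum>i\<in>Poly_Mapping.keys \<alpha>. Poly_Mapping.lookup \<alpha> i)"

definition in_vars :: "nat \<Rightarrow> 'a::zero mpoly \<Rightarrow> bool" where
  "in_vars n f \<longleftrightarrow> (\<forall>\<alpha>\<in>Poly_Mapping.keys f. Poly_Mapping.keys \<alpha> \<subseteq> {..n})"

definition hcomp :: "nat \<Rightarrow> 'a::zero mpoly \<Rightarrow> 'a mpoly" where
  "hcomp m f = Abs_poly_mapping (\<lambda>\<alpha>. Poly_Mapping.lookup f \<alpha> when mdeg \<alpha> = m)"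

definition hom_space :: "nat \<Rightarrow> nat \<Rightarrow> 'a::zero mpoly set" where
  "hom_space n m = {f. in_vars n f \<and> (\<forall>\<alpha>\<in>Poly_Mapping.keys f. mdeg \<alpha> = m)}"

definition mpoly_eval :: "'a::comm_ring_1 mpoly \<Rightarrow> (nat \<Rightarrow> 'a) \<Rightarrow> 'a" where
  "mpoly_eval f x = (\<Sum>\<alpha>\<in>Poly_Mapping.keys f. Poly_Mapping.lookup f \<alpha> * (\<Prod>i\<in>Poly_Mapping.keys \<alpha>. x i ^ Poly_Mapping.lookup \<alpha> i))"

definition smult_mp :: "'a::field \<Rightarrow> 'a mpoly \<Rightarrow> 'a mpoly" where
  "smult_mp c f = Poly_Mapping.map (\<lambda>a. c * a) f"

definition homog_prime_ideal :: "nat \<Rightarrow> 'a::field mpoly set \<Rightarrow> bool" where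
  "homog_prime_ideal n P \<longleftrightarrow>
     P \<subseteq> {f. in_vars n f} \<and> 0 \<in> P \<and>
     (\<forall>f\<in>P. \<forall>g\<in>P. f + g \<in> P) \<and>
     (\<forall>f\<in>P. \<forall>g. in_vars n g \<longrightarrow> g * f \<in> P) \<and>
     1 \<notin> P \<and>
     (\<forall>f g. in_vars n f \<longrightarrow> in_vars n g \<longrightarrow> f * g \<in> P \<longrightarrow> f \<in> P \<or> g \<in> P) \<and>
     (\<forall>f\<in>P. \<forall>m. hcomp m f \<in> P)"

text \<open>Hilbert function of the homogeneous coordinate ring F[x_0..x_n]/P:
  m \<mapsto> dim_F (S_m / P_m) = dim S_m - dim (P \<inter> S_m).\<close>
definition hilbert_fn :: "nat \<Rightarrow> 'a::field mpoly set \<Rightarrow> nat \<Rightarrow> nat" where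
  "hilbert_fn n P m =
     vector_space.dim smult_mp (hom_space n m :: 'a mpoly set)
     - vector_space.dim smult_mp (P \<inter> hom_space n m)"

text \<open>P is the (homogeneous prime) ideal of an F-irreducible projective curve in P^n
  of degree d: the Hilbert polynomial is d*m + c with d > 0 (dimension 1, degree d).\<close>
definition proj_curve_deg :: "nat \<Rightarrow> 'a::field mpoly set \<Rightarrow> nat \<Rightarrow> bool" where
  "proj_curve_deg n P d \<longleftrightarrow> homog_prime_ideal n P \<and> d > 0 \<and>
     (\<exists>c::int. \<forall>\<^sub>F m in sequentially. int (hilbert_fn n P m) = int d * int m + c)"

text \<open>F-rational points of the curve: points of P^n(F) (lines through nonzero
  vectors (x_0,...,x_n) of F^(n+1)) on which all elements of P vanish.\<close>
definition rational_points :: "nat \<Rightarrow> 'a::field mpoly set \<Rightarrow> (nat \<Rightarrow> 'a) set set" where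
  "rational_points n P =
     {{(\<lambda>i. c * x i) | c. c \<noteq> 0} | x. (\<forall>i>n. x i = 0) \<and> x \<noteq> (\<lambda>_. 0) \<and>
         (\<forall>f\<in>P. mpoly_eval f x = 0)}"

definition max_points :: "'a::{finite,field} itself \<Rightarrow> nat \<Rightarrow> ereal" where
  "max_points _ d = (SUP nP \<in> {(n, P :: 'a mpoly set). proj_curve_deg n P d}.
                        ereal (real (card (rational_points (fst nP) (snd nP)))))"

definition homma_const :: "'a::{finite,field} itself \<Rightarrow> ereal" where
  "homma_const T = limsup (\<lambda>d. max_points T d / ereal (real d))"

end

theory Submission
  imports Defs
begin

text \<open>
  Write \<open>S\<^sub>m\<close> for the forms of degree \<open>m\<close>. The bound comes from averaging the intersection
  multiplicities at the rational points over all hyperplanes. At a rational point \<open>x\<close> there is,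
  for every \<open>j\<close>, an ideal of colength \<open>j\<close> of the local ring of the curve lying between two
  consecutive powers of the maximal ideal; the linear forms in it have codimension at most \<open>j\<close> in
  \<open>S\<^sub>1\<close> and meet the curve at \<open>x\<close> with multiplicity at least \<open>j\<close>. Hence a random hyperplane meets
  the curve at \<open>x\<close> with expected multiplicity about \<open>1/q + 1/q^2 + \<dots> = 1/(q - 1)\<close>, whereas
  by Bezout a hyperplane not containing the curve has total multiplicity at most \<open>d\<close>. So the number
  \<open>N\<close> of points is essentially at most \<open>(q - 1) d\<close>. Cutting the series off after \<open>K\<close> terms, and
  discarding the linear forms that vanish on the curve, costs only an additive error depending on \<open>K\<close>,
  because \<open>N\<close> is at most the index of the latter forms in \<open>S\<^sub>1\<close>.

  Dimensions are replaced by cardinalities of finite subspaces throughout, and local multiplicities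
  by indices of subspaces in \<open>S\<^sub>m\<close> for a single large \<open>m\<close>.
\<close>

subsection \<open>Polynomials and forms\<close>

definition monom_val :: "(nat \<Rightarrow>\<^sub>0 nat) \<Rightarrow> (nat \<Rightarrow> 'a::comm_ring_1) \<Rightarrow> 'a" where
  "monom_val \<alpha> x = (\<Prod>i\<in>Poly_Mapping.keys \<alpha>. x i ^ Poly_Mapping.lookup \<alpha> i)"

definition var :: "nat \<Rightarrow> 'a::comm_ring_1 mpoly" where
  "var i = Poly_Mapping.single (Poly_Mapping.single i 1) 1"

section \<open>Evaluation at a point as a ring homomorphism\<close>

lemma monom_val_superset:
  assumes "finite A" "Poly_Mapping.keys \<alpha> \<subseteq> A"
  shows "monom_val \<alpha> x = (\<Prod>i\<in>A. x i ^ Poly_Mapping.lookup \<alpha> i)"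
  unfolding monom_val_def using assms
  by (intro prod.mono_neutral_left) (auto simp: in_keys_iff)

lemma monom_val_add: "monom_val (\<alpha> + \<beta>) x = monom_val \<alpha> x * monom_val \<beta> x"
proof -
  let ?A = "Poly_Mapping.keys \<alpha> \<union> Poly_Mapping.keys \<beta>"
  have "monom_val (\<alpha> + \<beta>) x = (\<Prod>i\<in>?A. x i ^ Poly_Mapping.lookup (\<alpha> + \<beta>) i)"
    using keys_add[of \<alpha> \<beta>] by (intro monom_val_superset) auto
  also have "\<dots> = monom_val \<alpha> x * monom_val \<beta> x"
    by (simp add: lookup_add power_add prod.distrib monom_val_superset[of ?A])
  finally show ?thesis .
qed

lemma mdeg_superset:
  assumes "finite A" "Poly_Mapping.keys \<alpha> \<subseteq> A"
  shows "mdeg \<alpha> = (\<Sum>i\<in>A. Poly_Mapping.lookup \<alpha> i)"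
  unfolding mdeg_def using assms
  by (intro sum.mono_neutral_left) (auto simp: in_keys_iff)

lemma mdeg_add: "mdeg (\<alpha> + \<beta>) = mdeg \<alpha> + mdeg \<beta>"
proof -
  let ?A = "Poly_Mapping.keys \<alpha> \<union> Poly_Mapping.keys \<beta>"
  have "mdeg (\<alpha> + \<beta>) = (\<Sum>i\<in>?A. Poly_Mapping.lookup (\<alpha> + \<beta>) i)"
    using keys_add[of \<alpha> \<beta>] by (intro mdeg_superset) auto
  also have "\<dots> = mdeg \<alpha> + mdeg \<beta>"
    by (simp add: lookup_add sum.distrib mdeg_superset[of ?A])
  finally show ?thesis .
qed

lemma mpoly_eval_superset:
  assumes "finite A" "Poly_Mapping.keys f \<subseteq> A"
  shows "mpoly_eval f x = (\<Sum>\<alpha>\<in>A. Poly_Mapping.lookup f \<alpha> * monom_val \<alpha> x)"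
  unfolding mpoly_eval_def monom_val_def using assms
  by (intro sum.mono_neutral_left) (auto simp: in_keys_iff)

lemma mpoly_eval_zero [simp]: "mpoly_eval 0 x = 0"
  by (simp add: mpoly_eval_def)

lemma mpoly_eval_add: "mpoly_eval (f + g) x = mpoly_eval f x + mpoly_eval g x"
proof -
  let ?A = "Poly_Mapping.keys f \<union> Poly_Mapping.keys g"
  have "mpoly_eval (f + g) x = (\<Sum>\<alpha>\<in>?A. Poly_Mapping.lookup (f + g) \<alpha> * monom_val \<alpha> x)"
    using keys_add[of f g] by (intro mpoly_eval_superset) auto
  also have "\<dots> = mpoly_eval f x + mpoly_eval g x"
    by (simp add: lookup_add distrib_right sum.distrib mpoly_eval_superset[of ?A])
  finally show ?thesis .
qed

lemma mpoly_eval_sum: "mpoly_eval (sum f A) x = (\<Sum>a\<in>A. mpoly_eval (f a) x)"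
  by (induction A rule: infinite_finite_induct) (simp_all add: mpoly_eval_add)

lemma mpoly_eval_single: "mpoly_eval (Poly_Mapping.single \<alpha> c) x = c * monom_val \<alpha> x"
  by (subst mpoly_eval_superset[of "{\<alpha>}"]) auto

lemma mpoly_eq_sum_single:
  "f = (\<Sum>\<alpha>\<in>Poly_Mapping.keys f. Poly_Mapping.single \<alpha> (Poly_Mapping.lookup f \<alpha>))"
  by (rule poly_mapping_eqI) (auto simp: lookup_sum lookup_single when_def in_keys_iff)

lemma mpoly_eval_mult: "mpoly_eval (f * g) x = mpoly_eval f x * mpoly_eval g x"
proof -
  let ?F = "Poly_Mapping.keys f" and ?G = "Poly_Mapping.keys g"
  let ?f = "Poly_Mapping.lookup f" and ?g = "Poly_Mapping.lookup g"
  have "mpoly_eval (f * g) x = mpoly_eval ((\<Sum>\<alpha>\<in>?F. Poly_Mapping.single \<alpha> (?f \<alpha>)) *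
      (\<Sum>\<beta>\<in>?G. Poly_Mapping.single \<beta> (?g \<beta>))) x"
    using mpoly_eq_sum_single[of f] mpoly_eq_sum_single[of g] by metis
  also have "\<dots> = (\<Sum>\<alpha>\<in>?F. \<Sum>\<beta>\<in>?G. (?f \<alpha> * ?g \<beta>) * monom_val (\<alpha> + \<beta>) x)"
    by (simp only: sum_product mult_single mpoly_eval_sum mpoly_eval_single)
  also have "\<dots> = (\<Sum>\<alpha>\<in>?F. \<Sum>\<beta>\<in>?G. (?f \<alpha> * monom_val \<alpha> x) * (?g \<beta> * monom_val \<beta> x))"
    by (intro sum.cong refl) (simp add: monom_val_add algebra_simps)
  also have "\<dots> = mpoly_eval f x * mpoly_eval g x"
    by (simp only: sum_product mpoly_eval_def monom_val_def)
  finally show ?thesis .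
qed

lemma mpoly_eval_one [simp]: "mpoly_eval 1 x = 1"
  using mpoly_eval_single[of 0 1 x] by (simp add: monom_val_def)

lemma mpoly_eval_power: "mpoly_eval (f ^ k) x = mpoly_eval f x ^ k"
  by (induction k) (simp_all add: mpoly_eval_mult)

lemma mpoly_eval_uminus: "mpoly_eval (- f) x = - mpoly_eval f x"
  using mpoly_eval_add[of f "- f" x] by (simp add: eq_neg_iff_add_eq_0 add.commute)

lemma mpoly_eval_diff: "mpoly_eval (f - g) x = mpoly_eval f x - mpoly_eval g x"
  using mpoly_eval_add[of f "- g" x] by (simp add: mpoly_eval_uminus)

lemma mpoly_eval_var [simp]: "mpoly_eval (var i) x = x i"
  by (simp add: var_def mpoly_eval_single monom_val_def)

lemma smult_mp_eq: "smult_mp c f = Poly_Mapping.single 0 c * f"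
  by (simp add: smult_mp_def mult_map_scale_conv_mult)

lemma lookup_smult_mp [simp]: "Poly_Mapping.lookup (smult_mp c f) \<alpha> = c * Poly_Mapping.lookup f \<alpha>"
  by (simp add: smult_mp_def Poly_Mapping.map.rep_eq when_def)

lemma mpoly_eval_smult_mp [simp]: "mpoly_eval (smult_mp c f) x = c * mpoly_eval f x"
  by (simp add: smult_mp_eq mpoly_eval_mult mpoly_eval_single monom_val_def)

global_interpretation mp: vector_space "smult_mp :: 'a::field \<Rightarrow> 'a mpoly \<Rightarrow> 'a mpoly"
  by unfold_locales (auto intro!: poly_mapping_eqI simp: lookup_add algebra_simps)

section \<open>Graded pieces of the polynomial ring\<close>

lemma in_vars_add: "in_vars n f \<Longrightarrow> in_vars n g \<Longrightarrow> in_vars n (f + g)"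
  unfolding in_vars_def using keys_add[of f g] by blast

lemma in_vars_mult:
  assumes "in_vars n f" "in_vars n g"
  shows "in_vars n (f * g)"
  unfolding in_vars_def
proof
  fix \<gamma> assume "\<gamma> \<in> Poly_Mapping.keys (f * g)"
  then obtain \<alpha> \<beta> where "\<gamma> = \<alpha> + \<beta>" "\<alpha> \<in> Poly_Mapping.keys f" "\<beta> \<in> Poly_Mapping.keys g"
    using keys_mult[of f g] by blast
  then show "Poly_Mapping.keys \<gamma> \<subseteq> {..n}"
    using assms keys_add[of \<alpha> \<beta>] unfolding in_vars_def by blast
qed

lemma in_vars_single [simp]: "in_vars n (Poly_Mapping.single 0 c)"
  by (auto simp: in_vars_def)

lemma in_vars_zero [simp]: "in_vars n 0"
  by (auto simp: in_vars_def)

lemma in_vars_one [simp]: "in_vars n (1 :: 'a::comm_ring_1 mpoly)"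
  by (auto simp: in_vars_def)

lemma in_vars_smult: "in_vars n f \<Longrightarrow> in_vars n (smult_mp c f)"
  by (simp add: smult_mp_eq in_vars_mult)

lemma in_vars_uminus: "in_vars n f \<Longrightarrow> in_vars n (- f :: 'a::comm_ring_1 mpoly)"
  by (auto simp: in_vars_def in_keys_iff)

lemma in_vars_diff:
  "in_vars n f \<Longrightarrow> in_vars n g \<Longrightarrow> in_vars n (f - g :: 'a::comm_ring_1 mpoly)"
  using in_vars_add[of n f "- g"] by (simp add: in_vars_uminus)

lemma hom_space_in_vars: "f \<in> hom_space n m \<Longrightarrow> in_vars n f"
  by (simp add: hom_space_def)

lemma subspace_hom_space: "mp.subspace (hom_space n m :: 'a::field mpoly set)"
proof (rule mp.subspaceI)
  fix f g :: "'a mpoly" assume "f \<in> hom_space n m" "g \<in> hom_space n m"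
  then show "f + g \<in> hom_space n m"
    using keys_add[of f g] by (auto simp: hom_space_def in_vars_add)
qed (auto simp: hom_space_def in_vars_smult in_keys_iff)

lemma hom_space_diff:
  "f \<in> hom_space n m \<Longrightarrow> g \<in> hom_space n m \<Longrightarrow> f - g \<in> hom_space n m" for f :: "'a::field mpoly"
  by (rule mp.subspace_diff[OF subspace_hom_space])

lemma hom_space_smult:
  "f \<in> hom_space n m \<Longrightarrow> smult_mp c f \<in> hom_space n m" for f :: "'a::field mpoly"
  by (rule mp.subspace_scale[OF subspace_hom_space])

lemma hom_space_mult:
  fixes f g :: "'a::comm_ring_1 mpoly"
  assumes "f \<in> hom_space n a" "g \<in> hom_space n b"
  shows "f * g \<in> hom_space n (a + b)"
proof -
  have "mdeg \<gamma> = a + b" if "\<gamma> \<in> Poly_Mapping.keys (f * g)" for \<gamma>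
  proof -
    from that obtain \<alpha> \<beta> where "\<gamma> = \<alpha> + \<beta>" "\<alpha> \<in> Poly_Mapping.keys f" "\<beta> \<in> Poly_Mapping.keys g"
      using keys_mult[of f g] by blast
    then show ?thesis
      using assms by (simp add: hom_space_def mdeg_add)
  qed
  then show ?thesis
    using assms by (simp add: hom_space_def in_vars_mult)
qed

lemma one_in_hom_space [simp]: "(1 :: 'a::comm_ring_1 mpoly) \<in> hom_space n 0"
  by (simp add: hom_space_def mdeg_def)

lemma hom_space_power: "(f :: 'a::comm_ring_1 mpoly) \<in> hom_space n a \<Longrightarrow> f ^ k \<in> hom_space n (k * a)"
  by (induction k) (use hom_space_mult in \<open>fastforce+\<close>)

lemma hom_space_power1: "(f :: 'a::comm_ring_1 mpoly) \<in> hom_space n 1 \<Longrightarrow> f ^ k \<in> hom_space n k"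
  using hom_space_power[of f n 1 k] by simp

lemma var_in_hom_space: "i \<le> n \<Longrightarrow> (var i :: 'a::comm_ring_1 mpoly) \<in> hom_space n 1"
  by (auto simp: hom_space_def var_def in_vars_def mdeg_def)

lemma hom_space_prod:
  fixes f :: "'b \<Rightarrow> 'a::comm_ring_1 mpoly"
  assumes "finite A" "\<And>a. a \<in> A \<Longrightarrow> f a \<in> hom_space n k"
  shows "prod f A \<in> hom_space n (card A * k)"
  using assms by (induction A rule: finite_induct) (auto intro: hom_space_mult)

lemma hom_space_0_const:
  assumes "f \<in> hom_space n 0"
  shows "f = Poly_Mapping.single 0 (Poly_Mapping.lookup f 0)"
proof (rule poly_mapping_eqI)
  fix \<alpha>
  show "Poly_Mapping.lookup f \<alpha> = Poly_Mapping.lookup (Poly_Mapping.single 0 (Poly_Mapping.lookup f 0)) \<alpha>"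
  proof (cases "\<alpha> = 0")
    case False
    then obtain i where "i \<in> Poly_Mapping.keys \<alpha>"
      by (metis keys_eq_empty all_not_in_conv)
    then have "mdeg \<alpha> \<noteq> 0"
      by (auto simp: mdeg_def in_keys_iff)
    then have "\<alpha> \<notin> Poly_Mapping.keys f"
      using assms by (auto simp: hom_space_def)
    then show ?thesis
      using False by (simp add: lookup_single_not_eq in_keys_iff)
  qed simp
qed

lemma finite_poly_mapping_bounded:
  assumes "finite A" "finite B"
  shows "finite {f :: 'k \<Rightarrow>\<^sub>0 'v::zero. Poly_Mapping.keys f \<subseteq> A \<and> (\<forall>i. Poly_Mapping.lookup f i \<in> B)}"
proof -
  let ?S = "{f :: 'k \<Rightarrow>\<^sub>0 'v. Poly_Mapping.keys f \<subseteq> A \<and> (\<forall>i. Poly_Mapping.lookup f i \<in> B)}"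
  have "Poly_Mapping.lookup ` ?S \<subseteq> {g. \<forall>i. (i \<in> A \<longrightarrow> g i \<in> B) \<and> (i \<notin> A \<longrightarrow> g i = 0)}"
    by (auto simp: in_keys_iff)
  then have "finite (Poly_Mapping.lookup ` ?S)"
    by (rule finite_subset) (rule finite_set_of_finite_funs[OF assms])
  then show ?thesis
    by (rule finite_imageD) (auto intro: inj_onI poly_mapping_eqI)
qed

text \<open>Exponents of a monomial are bounded by its degree, and the field is finite. This
  finiteness lets cardinalities stand in for dimensions.\<close>

lemma finite_hom_space: "finite (hom_space n m :: 'a::{finite,field} mpoly set)"
proof -
  let ?M = "{\<alpha> :: nat \<Rightarrow>\<^sub>0 nat. Poly_Mapping.keys \<alpha> \<subseteq> {..n} \<and> (\<forall>i. Poly_Mapping.lookup \<alpha> i \<in> {..m})}"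
  have "Poly_Mapping.lookup \<alpha> i \<le> mdeg \<alpha>" for \<alpha> i
    by (cases "i \<in> Poly_Mapping.keys \<alpha>") (auto simp: mdeg_def in_keys_iff intro: member_le_sum)
  then have "hom_space n m \<subseteq> {f :: 'a mpoly. Poly_Mapping.keys f \<subseteq> ?M \<and> (\<forall>i. Poly_Mapping.lookup f i \<in> UNIV)}"
    by (fastforce simp: hom_space_def in_vars_def)
  then show ?thesis
    by (rule finite_subset) (intro finite_poly_mapping_bounded, auto)
qed

lemma hom_space_Suc_monom:
  fixes c :: "'a::comm_ring_1"
  assumes "mdeg \<alpha> = Suc m" "Poly_Mapping.keys \<alpha> \<subseteq> {..n}"
  obtains i h where "i \<le> n" "h \<in> hom_space n m" "Poly_Mapping.single \<alpha> c = var i * h"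
proof -
  from assms have "\<alpha> \<noteq> 0" by (auto simp: mdeg_def)
  then obtain i where i: "i \<in> Poly_Mapping.keys \<alpha>"
    by (metis keys_eq_empty all_not_in_conv)
  define \<beta> where "\<beta> = \<alpha> - Poly_Mapping.single i 1"
  have \<alpha>: "\<alpha> = Poly_Mapping.single i 1 + \<beta>"
    using i by (intro poly_mapping_eqI)
      (auto simp: \<beta>_def lookup_add lookup_minus lookup_single when_def in_keys_iff)
  have "mdeg (Poly_Mapping.single i 1) = 1"
    by (simp add: mdeg_def)
  with assms(1) have "mdeg \<beta> = m"
    by (simp add: \<alpha> mdeg_add)
  moreover have "Poly_Mapping.keys \<beta> \<subseteq> Poly_Mapping.keys \<alpha>"
    by (auto simp: \<beta>_def in_keys_iff lookup_minus)
  ultimately have "Poly_Mapping.single \<beta> c \<in> hom_space n m"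
    using assms(2) by (auto simp: hom_space_def in_vars_def)
  moreover have "Poly_Mapping.single \<alpha> c = var i * Poly_Mapping.single \<beta> c"
    by (simp add: var_def mult_single \<alpha>)
  ultimately show ?thesis
    using that i assms(2) by blast
qed

text \<open>Every monomial of positive degree contains a variable, so a form of degree
  \<open>Suc m\<close> is built from 0 by adding terms \<open>var i * h\<close>.\<close>

lemma hom_space_Suc_induct [consumes 1, case_names zero add]:
  fixes g :: "'a::comm_ring_1 mpoly"
  assumes "g \<in> hom_space n (Suc m)" "Q 0"
    and step: "\<And>i h f. i \<le> n \<Longrightarrow> h \<in> hom_space n m \<Longrightarrow> Q f \<Longrightarrow> Q (var i * h + f)"
  shows "Q g"
proof -
  have "Q (\<Sum>\<alpha>\<in>A. Poly_Mapping.single \<alpha> (Poly_Mapping.lookup g \<alpha>))"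
    if "finite A" "A \<subseteq> Poly_Mapping.keys g" for A
    using that
  proof (induction A rule: finite_induct)
    case (insert \<alpha> A)
    then have "mdeg \<alpha> = Suc m" "Poly_Mapping.keys \<alpha> \<subseteq> {..n}"
      using assms(1) by (auto simp: hom_space_def in_vars_def)
    then obtain i h where "i \<le> n" "h \<in> hom_space n m"
      "Poly_Mapping.single \<alpha> (Poly_Mapping.lookup g \<alpha>) = var i * h"
      by (rule hom_space_Suc_monom)
    then show ?case
      using insert step by simp
  qed (use assms(2) in simp)
  from this[of "Poly_Mapping.keys g"] show ?thesis
    using mpoly_eq_sum_single[of g] by simp
qed

subsection \<open>Counting in finite vector spaces\<close>

text \<open>The counting uses only the additive structure. Working with subgroups also covers
  products such as \<open>A \<times> B\<close>, for which no vector space structure is set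
  up.\<close>

definition add_subgroup :: "'a::ab_group_add set \<Rightarrow> bool" where
  "add_subgroup A \<longleftrightarrow> 0 \<in> A \<and> (\<forall>a\<in>A. \<forall>b\<in>A. a - b \<in> A)"

lemma add_subgroup_add: "add_subgroup A \<Longrightarrow> a \<in> A \<Longrightarrow> b \<in> A \<Longrightarrow> a + b \<in> A"
  unfolding add_subgroup_def by (metis diff_0 diff_minus_eq_add)

text \<open>First isomorphism theorem as a count: each nonempty fibre is a translate of the
  kernel.\<close>

lemma card_image_times_kernel:
  fixes f :: "'a::ab_group_add \<Rightarrow> 'b::ab_group_add"
  assumes A: "add_subgroup A" "finite A" and f: "\<And>a b. f (a - b) = f a - f b"
  shows "card A = card (f ` A) * card {a \<in> A. f a = 0}"
proof -
  have fibre: "card {a \<in> A. f a = f b} = card {a \<in> A. f a = 0}" if b: "b \<in> A" for b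
  proof (rule bij_betw_same_card)
    show "bij_betw (\<lambda>a. a - b) {a \<in> A. f a = f b} {a \<in> A. f a = 0}"
    proof (rule bij_betwI[where g = "\<lambda>a. a + b"])
      have "f (a + b) = f a + f b" for a
        using f[of "a + b" b] by (simp add: algebra_simps)
      then show "(\<lambda>a. a + b) \<in> {a \<in> A. f a = 0} \<rightarrow> {a \<in> A. f a = f b}"
        using A(1) b by (auto simp: add_subgroup_add)
    qed (use A(1) b f in \<open>auto simp: add_subgroup_def\<close>)
  qed
  have "A = (\<Union>y\<in>f ` A. {a \<in> A. f a = y})"
    by blast
  then have "card A = (\<Sum>y\<in>f ` A. card {a \<in> A. f a = y})"
    using A(2) by (subst (1) \<open>A = _\<close>, intro card_UN_disjoint) auto
  also have "\<dots> = (\<Sum>y\<in>f ` A. card {a \<in> A. f a = 0})"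
    using fibre by (intro sum.cong) auto
  finally show ?thesis
    by simp
qed

definition sumset :: "'a::ab_group_add set \<Rightarrow> 'a set \<Rightarrow> 'a set" where
  "sumset A B = (\<lambda>(a, b). a + b) ` (A \<times> B)"

text \<open>Second isomorphism theorem as a count: the kernel of addition on
  \<open>A \<times> B\<close> is the antidiagonal copy of \<open>A \<inter> B\<close>.\<close>

lemma card_sumset:
  assumes "add_subgroup A" "add_subgroup B" "finite A" "finite B"
  shows "card (sumset A B) * card (A \<inter> B) = card A * card B"
proof -
  have "add_subgroup (A \<times> B)"
    using assms by (auto simp: add_subgroup_def zero_prod_def)
  moreover have "{z \<in> A \<times> B. (\<lambda>(a, b). a + b) z = 0} = (\<lambda>a. (a, - a)) ` (A \<inter> B)"
  proof -
    have "- a \<in> B \<longleftrightarrow> a \<in> B" for a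
      using assms(2) unfolding add_subgroup_def by (metis diff_0 minus_minus)
    then show ?thesis
      by (auto simp: image_iff add_eq_0_iff2)
  qed
  ultimately have "card (A \<times> B) = card (sumset A B) * card ((\<lambda>a. (a, - a)) ` (A \<inter> B))"
    unfolding sumset_def using assms
    by (subst card_image_times_kernel[where f = "\<lambda>(a, b). a + b"]) auto
  then show ?thesis
    by (simp add: card_cartesian_product card_image inj_on_def)
qed

text \<open>The quotient of \<open>A\<close> by the preimage of \<open>J\<close> embeds into the
  quotient of \<open>S\<close> by \<open>J\<close>, so the index can only drop. Both indices are
  multiplied out to avoid division.\<close>

lemma card_vimage_subgroup_ge:
  fixes f :: "'a::ab_group_add \<Rightarrow> 'b::ab_group_add"
  assumes "add_subgroup A" "finite A" "add_subgroup S" "finite S" "add_subgroup J" "J \<subseteq> S"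
    and f: "\<And>a b. f (a - b) = f a - f b" and fA: "f ` A \<subseteq> S"
  shows "card A * card J \<le> card {a \<in> A. f a \<in> J} * card S"
proof -
  let ?B = "{a \<in> A. f a \<in> J}" and ?k = "card {a \<in> A. f a = 0}"
  have f0: "f 0 = 0"
    using f[of 0 0] by simp
  have img: "add_subgroup (f ` A)"
    unfolding add_subgroup_def
  proof (intro conjI ballI)
    show "0 \<in> f ` A"
      using assms(1) f0 by (metis add_subgroup_def image_eqI)
    fix u v assume "u \<in> f ` A" "v \<in> f ` A"
    then obtain a b where "a \<in> A" "b \<in> A" "u = f a" "v = f b"
      by blast
    then show "u - v \<in> f ` A"
      using assms(1) by (auto simp: add_subgroup_def simp flip: f)
  qed
  have "add_subgroup ?B"
    using assms(1,5) f f0 by (auto simp: add_subgroup_def)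
  then have "card ?B = card (f ` ?B) * card {a \<in> ?B. f a = 0}"
    using assms(2) f by (intro card_image_times_kernel) auto
  moreover have "{a \<in> ?B. f a = 0} = {a \<in> A. f a = 0}" "f ` ?B = f ` A \<inter> J"
    using assms(5) by (auto simp: add_subgroup_def)
  ultimately have B: "card ?B = card (f ` A \<inter> J) * ?k"
    by simp
  have "sumset (f ` A) J \<subseteq> S"
    using fA assms(3,6) by (auto simp: sumset_def add_subgroup_add subset_iff)
  then have "card (f ` A) * card J \<le> card S * card (f ` A \<inter> J)"
    using card_sumset[OF img assms(5)] assms(2,4,6) finite_subset
    by (metis card_mono finite_imageI mult_le_mono1)
  then have "card (f ` A) * card J * ?k \<le> card S * card (f ` A \<inter> J) * ?k"
    by (rule mult_le_mono1)
  then show ?thesis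
    unfolding B card_image_times_kernel[OF assms(1,2) f] by (simp add: mult_ac)
qed

section \<open>Subspaces over a finite field\<close>

context vector_space
begin

lemma subspace_add_subgroup: "subspace V \<Longrightarrow> add_subgroup V"
  by (simp add: add_subgroup_def subspace_0 subspace_diff)

lemma card_span_insert:
  assumes "finite (UNIV :: 'a set)" "v \<notin> span B"
  shows "card (span (insert v B)) = CARD('a) * card (span B)"
proof -
  have "bij_betw (\<lambda>(c, y). scale c v + y) ((UNIV :: 'a set) \<times> span B) (span (insert v B))"
  proof (rule bij_betw_imageI)
    show "inj_on (\<lambda>(c, y). scale c v + y) ((UNIV :: 'a set) \<times> span B)"
    proof (rule inj_onI, clarsimp)
      fix c c' y y' assume y: "y \<in> span B" "y' \<in> span B" and eq: "scale c v + y = scale c' v + y'"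
      have "scale (c - c') v = y' - y"
        using eq by (simp add: algebra_simps scale_left_diff_distrib)
      then have "scale (c - c') v \<in> span B"
        using y by (simp add: span_diff)
      have "c = c'"
      proof (rule ccontr)
        assume "c \<noteq> c'"
        then have "scale (inverse (c - c')) (scale (c - c') v) = v"
          by simp
        then show False
          using \<open>scale (c - c') v \<in> span B\<close> assms(2) span_scale by metis
      qed
      with eq show "c = c' \<and> y = y'"
        by simp
    qed
    show "(\<lambda>(c, y). scale c v + y) ` ((UNIV :: 'a set) \<times> span B) = span (insert v B)"
    proof (intro equalityI subsetI)
      fix z assume "z \<in> span (insert v B)"
      then obtain c where "z - scale c v \<in> span B"
        by (auto simp: span_insert)
      then show "z \<in> (\<lambda>(c, y). scale c v + y) ` ((UNIV :: 'a set) \<times> span B)"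
        by (intro image_eqI[of _ _ "(c, z - scale c v)"]) auto
    next
      fix z assume "z \<in> (\<lambda>(c, y). scale c v + y) ` ((UNIV :: 'a set) \<times> span B)"
      then obtain c y where "y \<in> span B" "z = scale c v + y"
        by auto
      then have "z - scale c v \<in> span B"
        by simp
      then show "z \<in> span (insert v B)"
        by (auto simp: span_insert)
    qed
  qed
  then show ?thesis
    by (metis bij_betw_same_card card_cartesian_product)
qed

lemma card_span_independent:
  assumes "finite (UNIV :: 'a set)" "finite B" "independent B"
  shows "card (span B) = CARD('a) ^ card B"
  using assms(2,3)
proof (induction B rule: finite_induct)
  case (insert v B)
  then show ?case
    using assms(1) by (simp add: card_span_insert independent_insert)
qed simp

lemma card_subspace:
  assumes "finite (UNIV :: 'a set)" "subspace V" "finite V"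
  shows "card V = CARD('a) ^ dim V"
proof -
  obtain B where B: "B \<subseteq> V" "independent B" "V \<subseteq> span B" "card B = dim V"
    by (rule basis_exists)
  then have "V = span B"
    using assms(2) span_minimal by blast
  then show ?thesis
    using card_span_independent[of B] assms(1,3) B finite_subset by metis
qed

text \<open>\<open>U\<close> is a maximal proper subspace of \<open>V\<close> above
  \<open>W\<close>: adjoining any vector of \<open>V\<close> outside \<open>U\<close> must already
  give all of \<open>V\<close>.\<close>

lemma exists_subspace_index_card:
  assumes "finite (UNIV :: 'a set)" "finite V" "subspace V" "subspace W" "W \<subset> V"
  obtains U where "subspace U" "W \<subseteq> U" "U \<subseteq> V" "card V = CARD('a) * card U"
proof -
  define A where "A = {U. subspace U \<and> W \<subseteq> U \<and> U \<subset> V}"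
  have "finite A"
    by (rule finite_subset[of _ "Pow V"]) (use assms(2) in \<open>auto simp: A_def\<close>)
  moreover have "W \<in> A"
    using assms by (simp add: A_def)
  ultimately obtain U where "U \<in> A" and max: "\<And>U'. U' \<in> A \<Longrightarrow> U \<subseteq> U' \<Longrightarrow> U = U'"
    using finite_has_maximal[of A] by blast
  then have U: "subspace U" "W \<subseteq> U" "U \<subset> V"
    by (simp_all add: A_def)
  then obtain v where v: "v \<in> V" "v \<notin> U"
    by blast
  have "span U = U"
    using U by (simp add: span_eq_iff)
  have "span (insert v U) \<subseteq> V"
    using U v assms(3) by (intro span_minimal) auto
  moreover have "span (insert v U) \<noteq> U" "U \<subseteq> span (insert v U)"
    using v span_superset[of "insert v U"] by auto
  ultimately have "span (insert v U) = V"
    using max[of "span (insert v U)"] U(2) by (auto simp: A_def)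
  then have "card V = CARD('a) * card U"
    using card_span_insert[of v U] assms(1) v \<open>span U = U\<close> by simp
  with that[of U] U show ?thesis
    by auto
qed

end

subsection \<open>The filtration at a rational point\<close>

text \<open>Finite sums of products \<open>c * v\<close> plus one element of \<open>P\<close>. The
  coefficient set \<open>C\<close> is left arbitrary so that one notion covers ideals, coefficients
  vanishing at a point, and coefficients of one fixed degree.\<close>

inductive_set lin_comb :: "'b::comm_ring_1 set \<Rightarrow> 'b set \<Rightarrow> 'b set \<Rightarrow> 'b set" for C V P where
  base: "p \<in> P \<Longrightarrow> p \<in> lin_comb C V P"
| step: "c \<in> C \<Longrightarrow> v \<in> V \<Longrightarrow> s \<in> lin_comb C V P \<Longrightarrow> c * v + s \<in> lin_comb C V P"

lemma lin_comb_add: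
  assumes "\<And>p q. p \<in> P \<Longrightarrow> q \<in> P \<Longrightarrow> p + q \<in> P" "0 \<in> P"
    and "r \<in> lin_comb C V P" "s \<in> lin_comb C V P"
  shows "r + s \<in> lin_comb C V P"
  using assms(3)
proof induction
  case (base p)
  show ?case
    using assms(4)
  proof induction
    case (base q)
    then show ?case
      using assms(1) \<open>p \<in> P\<close> by (blast intro: lin_comb.base)
  next
    case (step c v s)
    then have "c * v + (p + s) \<in> lin_comb C V P"
      by (blast intro: lin_comb.step)
    then show ?case
      by (simp add: algebra_simps)
  qed
next
  case (step c v r)
  then have "c * v + (r + s) \<in> lin_comb C V P"
    by (blast intro: lin_comb.step)
  then show ?case
    by (simp add: algebra_simps)
qed

lemma lin_comb_image:
  assumes "s \<in> lin_comb C V P" "\<And>p. p \<in> P \<Longrightarrow> r * p \<in> P'"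
    and "\<And>c v. c \<in> C \<Longrightarrow> v \<in> V \<Longrightarrow> \<exists>c'\<in>C'. \<exists>v'\<in>V'. r * (c * v) = c' * v'"
  shows "r * s \<in> lin_comb C' V' P'"
  using assms(1)
proof induction
  case (step c v s)
  then obtain c' v' where "c' \<in> C'" "v' \<in> V'" "r * (c * v) = c' * v'"
    using assms(3) by blast
  with step show ?case
    by (simp add: distrib_left lin_comb.step)
qed (use assms(2) in \<open>blast intro: lin_comb.base\<close>)

lemma lin_comb_mult:
  assumes "s \<in> lin_comb C V P" "\<And>p. p \<in> P \<Longrightarrow> r * p \<in> P'" "\<And>c. c \<in> C \<Longrightarrow> r * c \<in> C'"
  shows "r * s \<in> lin_comb C' V P'"
  using assms(1,2)
proof (rule lin_comb_image)
  fix c v assume "c \<in> C" "v \<in> V"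
  then show "\<exists>c'\<in>C'. \<exists>v'\<in>V. r * (c * v) = c' * v'"
    using assms(3)[of c] by (metis mult.assoc)
qed

text \<open>Collecting all terms in \<open>w\<close> into one coefficient is the elimination step in
  the proof of Nakayama's lemma.\<close>

lemma lin_comb_insertE:
  assumes "s \<in> lin_comb C (insert w V) P" "0 \<in> C" "\<And>c d. c \<in> C \<Longrightarrow> d \<in> C \<Longrightarrow> c + d \<in> C"
  obtains c s' where "c \<in> C" "s' \<in> lin_comb C V P" "s = c * w + s'"
proof -
  have "\<exists>c\<in>C. \<exists>s'\<in>lin_comb C V P. s = c * w + s'"
    using assms(1)
  proof induction
    case (base p)
    then show ?case
      using assms(2) by (intro bexI[of _ 0] bexI[of _ p]) (auto intro: lin_comb.base)
  next
    case (step d v s)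
    then obtain c s' where *: "c \<in> C" "s' \<in> lin_comb C V P" "s = c * w + s'"
      by blast
    show ?case
    proof (cases "v = w")
      case True
      with * step assms(3) show ?thesis
        by (intro bexI[of _ "d + c"] bexI[of _ s']) (auto simp: algebra_simps)
    next
      case False
      then have "d * v + s' \<in> lin_comb C V P"
        using * step by (auto intro: lin_comb.step)
      moreover have "d * v + s = c * w + (d * v + s')"
        using * by (simp add: algebra_simps)
      ultimately show ?thesis
        using * by blast
    qed
  qed
  with that show ?thesis
    by blast
qed

lemma lin_comb_mono:
  assumes "C \<subseteq> C'" "V \<subseteq> V'" "P \<subseteq> P'"
  shows "lin_comb C V P \<subseteq> lin_comb C' V' P'"
proof
  fix s assume "s \<in> lin_comb C V P"
  then show "s \<in> lin_comb C' V' P'"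
    by induction (use assms in \<open>auto intro: lin_comb.intros\<close>)
qed

section \<open>The ambient ring and the homogeneous prime ideal\<close>

locale homog_prime =
  fixes n :: nat and P :: "'a::{finite,field} mpoly set"
  assumes prime: "homog_prime_ideal n P"
begin

definition R :: "'a mpoly set" where "R = {f. in_vars n f}"

lemma P_subset: "P \<subseteq> R" and P_zero: "0 \<in> P"
  and P_add: "f \<in> P \<Longrightarrow> g \<in> P \<Longrightarrow> f + g \<in> P"
  and P_mult: "f \<in> P \<Longrightarrow> g \<in> R \<Longrightarrow> g * f \<in> P"
  and one_notin_P: "1 \<notin> P"
  and P_prime: "f \<in> R \<Longrightarrow> g \<in> R \<Longrightarrow> f * g \<in> P \<Longrightarrow> f \<in> P \<or> g \<in> P"
  using prime by (auto simp: homog_prime_ideal_def R_def)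

lemma R_zero: "0 \<in> R" and R_one: "1 \<in> R" and R_add: "f \<in> R \<Longrightarrow> g \<in> R \<Longrightarrow> f + g \<in> R"
  and R_mult: "f \<in> R \<Longrightarrow> g \<in> R \<Longrightarrow> f * g \<in> R" and R_diff: "f \<in> R \<Longrightarrow> g \<in> R \<Longrightarrow> f - g \<in> R"
  and R_hom: "f \<in> hom_space n m \<Longrightarrow> f \<in> R"
  by (auto simp: R_def in_vars_add in_vars_mult in_vars_diff hom_space_in_vars)

lemma R_power: "f \<in> R \<Longrightarrow> f ^ k \<in> R"
  by (induction k) (auto simp: R_one R_mult)

lemma P_smult: "f \<in> P \<Longrightarrow> smult_mp c f \<in> P"
  by (simp add: smult_mp_eq P_mult R_def)

lemma P_diff: "f \<in> P \<Longrightarrow> g \<in> P \<Longrightarrow> f - g \<in> P"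
  using P_add[of f "smult_mp (-1) g"] P_smult[of g "-1"] by simp

lemma subspace_P: "mp.subspace P"
  by (rule mp.subspaceI) (auto simp: P_zero P_add P_smult)

lemma P_power: "f \<in> R \<Longrightarrow> f ^ k \<in> P \<Longrightarrow> f \<in> P"
  by (induction k) (use P_prime R_power one_notin_P in auto)

lemma subspace_P_hom: "mp.subspace (P \<inter> hom_space n m)"
  by (intro mp.subspace_inter subspace_P subspace_hom_space)

end

text \<open>The form \<open>t\<close> dehomogenises at \<open>x\<close>: multiplying by its powers
  raises the degree of a form and keeps its value at \<open>x\<close>.\<close>

locale rational_point = homog_prime n P for n :: nat and P :: "'a::{finite,field} mpoly set" +
  fixes x :: "nat \<Rightarrow> 'a" and t :: "'a mpoly"
  assumes vanish: "f \<in> P \<Longrightarrow> mpoly_eval f x = 0"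
    and t: "t \<in> hom_space n 1" "mpoly_eval t x = 1"
begin

definition L :: "'a mpoly set" where
  "L = {l \<in> hom_space n 1. mpoly_eval l x = 0}"

text \<open>Modulo \<open>P\<close>, these products generate the \<open>k\<close>-th power of the
  ideal of the point. They are kept as a finite set of generators because Nakayama's lemma is
  applied to them.\<close>

primrec V :: "nat \<Rightarrow> 'a mpoly set" where
  "V 0 = {1}"
| "V (Suc k) = {l * v | l v. l \<in> L \<and> v \<in> V k}"

definition I :: "nat \<Rightarrow> 'a mpoly set" where
  "I k = lin_comb R (V k) P"

text \<open>The contraction to \<open>R\<close> of the extension of \<open>I k\<close> to the local ring at \<open>x\<close>.\<close>
definition Q :: "nat \<Rightarrow> 'a mpoly set" where
  "Q k = {f \<in> R. \<exists>u\<in>R. mpoly_eval u x \<noteq> 0 \<and> u * f \<in> I k}"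

lemma V_hom: "V k \<subseteq> hom_space n k"
proof (induction k)
  case (Suc k)
  show ?case
  proof
    fix f assume "f \<in> V (Suc k)"
    then obtain l v where "l \<in> L" "v \<in> V k" "f = l * v" by auto
    then show "f \<in> hom_space n (Suc k)"
      using hom_space_mult[of l n 1 v k] Suc by (auto simp: L_def)
  qed
qed simp

lemma finite_V: "finite (V k)"
  using finite_subset[OF V_hom finite_hom_space] .

lemma power_in_V: "l \<in> L \<Longrightarrow> l ^ k \<in> V k"
  by (induction k) auto

lemma L_R: "l \<in> L \<Longrightarrow> l \<in> R"
  using R_hom by (auto simp: L_def)

lemma t_R: "t \<in> R"
  using t R_hom by blast

lemma t_power: "t ^ k \<in> hom_space n k"
  using t(1) by (rule hom_space_power1)

lemma I_add: "f \<in> I k \<Longrightarrow> g \<in> I k \<Longrightarrow> f + g \<in> I k"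
  unfolding I_def by (rule lin_comb_add) (auto simp: P_add P_zero)

lemma I_mult: "f \<in> I k \<Longrightarrow> r \<in> R \<Longrightarrow> r * f \<in> I k"
  unfolding I_def by (erule lin_comb_mult) (auto simp: P_mult R_mult)

lemma P_I: "P \<subseteq> I k"
  unfolding I_def by (auto intro: lin_comb.base)

lemma V_I: "v \<in> V k \<Longrightarrow> v \<in> I k"
  unfolding I_def using lin_comb.step[of 1 R v "V k" 0 P] P_zero R_one lin_comb.base[of 0 P]
  by simp

lemma I_0: "I 0 = R"
proof -
  have "f \<in> I 0" if "f \<in> R" for f
    using lin_comb.step[of f R 1 "V 0" 0 P] that P_zero by (auto simp: I_def intro: lin_comb.base)
  moreover have "f \<in> R" if "f \<in> I 0" for f
    using that unfolding I_def by induction (use P_subset in \<open>auto simp: R_add\<close>)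
  ultimately show ?thesis by blast
qed

lemma I_Suc: "I (Suc k) \<subseteq> I k"
proof
  fix f assume "f \<in> I (Suc k)"
  then show "f \<in> I k"
    unfolding I_def
  proof induction
    case (step c v s)
    then obtain l w where "l \<in> L" "w \<in> V k" "v = l * w"
      by auto
    with step have "(c * l) * w + s \<in> lin_comb R (V k) P"
      by (intro lin_comb.step) (auto simp: R_mult L_R)
    then show ?case
      by (simp add: \<open>v = l * w\<close> mult.assoc)
  qed (auto intro: lin_comb.base)
qed

lemma L_mult_I: "l \<in> L \<Longrightarrow> f \<in> I k \<Longrightarrow> l * f \<in> I (Suc k)"
  unfolding I_def
proof (erule lin_comb_image)
  fix c v assume "l \<in> L" "c \<in> R" "v \<in> V k"
  then show "\<exists>c'\<in>R. \<exists>v'\<in>V (Suc k). l * (c * v) = c' * v'"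
    by (intro bexI[of _ c] bexI[of _ "l * v"]) (auto simp: mult_ac)
qed (auto simp: P_mult L_R)

text \<open>Modulo \<open>L\<close> each variable \<open>var i\<close> equals \<open>x i\<close>
  times \<open>t\<close>, so a form of degree \<open>m\<close> reduces to its value times
  \<open>t ^ m\<close>. The coefficient set is the space of forms of degree \<open>m - 1\<close>,
  written so that it is empty for \<open>m = 0\<close>; the remainder of a constant is then
  0.\<close>

lemma hom_space_decomp:
  assumes "g \<in> hom_space n m"
  shows "\<exists>s\<in>lin_comb {h. \<exists>m'. m = Suc m' \<and> h \<in> hom_space n m'} L {0}.
    g = smult_mp (mpoly_eval g x) (t ^ m) + s"
  using assms
proof (induction m arbitrary: g)
  case 0
  then obtain c where "g = smult_mp c 1"
    using hom_space_0_const[of g n] by (simp add: smult_mp_eq)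
  then show ?case
    by (intro bexI[of _ 0]) (auto intro: lin_comb.base)
next
  case (Suc m)
  let ?D = "lin_comb {h. \<exists>m'. Suc m = Suc m' \<and> h \<in> hom_space n m'} L {0}"
  from Suc.prems show ?case
  proof (induction rule: hom_space_Suc_induct)
    case zero
    then show ?case
      by (intro bexI[of _ 0]) (auto intro: lin_comb.base)
  next
    case (add i h f)
    obtain r where r: "r \<in> lin_comb {h. \<exists>m'. m = Suc m' \<and> h \<in> hom_space n m'} L {0}"
      and h: "h = smult_mp (mpoly_eval h x) (t ^ m) + r"
      using Suc.IH[OF add(2)] by blast
    obtain s where s: "s \<in> ?D" "f = smult_mp (mpoly_eval f x) (t ^ Suc m) + s"
      using add(3) by blast
    \<comment> \<open>This splits \<open>var i\<close> into its value times \<open>t\<close> and a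
      form in \<open>L\<close>.\<close>
    define l where "l = var i - smult_mp (x i) t"
    have "var i \<in> hom_space n 1"
      using add(1) by (rule var_in_hom_space)
    then have "l \<in> hom_space n 1"
      unfolding l_def using t(1) by (intro hom_space_diff hom_space_smult)
    then have l: "l \<in> L"
      using t(2) by (simp add: L_def l_def mpoly_eval_diff)
    have "smult_mp (x i) t * r \<in> ?D"
      using r
    proof (rule lin_comb_mult)
      fix c :: "'a mpoly" assume "c \<in> {h. \<exists>m'. m = Suc m' \<and> h \<in> hom_space n m'}"
      then obtain m' where "m = Suc m'" "c \<in> hom_space n m'"
        by blast
      moreover have "smult_mp (x i) t \<in> hom_space n 1"
        using t by (simp add: hom_space_smult)
      ultimately show "smult_mp (x i) t * c \<in> {h. \<exists>m'. Suc m = Suc m' \<and> h \<in> hom_space n m'}"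
        using hom_space_mult[of "smult_mp (x i) t" n 1 c m'] by simp
    qed simp
    then have rs: "smult_mp (x i) t * r + s \<in> ?D"
      using s(1) by (intro lin_comb_add) auto
    have "h * l + (smult_mp (x i) t * r + s) \<in> ?D"
      by (rule lin_comb.step) (use add(2) l rs in auto)
    moreover have "var i * h + f = smult_mp (mpoly_eval (var i * h + f) x) (t ^ Suc m) +
        (h * l + (smult_mp (x i) t * r + s))"
    proof -
      have "var i * h = l * h + smult_mp (x i) t * (smult_mp (mpoly_eval h x) (t ^ m) + r)"
        using h by (simp add: l_def algebra_simps)
      also have "\<dots> = smult_mp (x i * mpoly_eval h x) (t ^ Suc m) + (h * l + smult_mp (x i) t * r)"
        by (simp add: smult_mp_eq algebra_simps mult_single)
      finally have "var i * h + f = smult_mp (x i * mpoly_eval h x) (t ^ Suc m) + (h * l + smult_mp (x i) t * r)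
          + (smult_mp (mpoly_eval f x) (t ^ Suc m) + s)"
        using s(2) by (rule arg_cong2[where f = "(+)"])
      moreover have "mpoly_eval (var i * h + f) x = x i * mpoly_eval h x + mpoly_eval f x"
        by (simp add: mpoly_eval_add mpoly_eval_mult)
      ultimately show ?thesis
        by (simp only: mp.scale_left_distrib add_ac)
    qed
    ultimately show ?case
      by blast
  qed
qed

lemma hom_space_vanish:
  assumes "g \<in> hom_space n (Suc m)" "mpoly_eval g x = 0"
  shows "g \<in> lin_comb (hom_space n m) L {0}"
  using hom_space_decomp[OF assms(1)] assms(2) by simp

text \<open>A form vanishing at \<open>x\<close> is a combination of members of \<open>L\<close>,
  and each of these raises the power by one.\<close>

lemma vanish_mult_I:
  assumes "g \<in> hom_space n m" "mpoly_eval g x = 0" "f \<in> I k"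
  shows "g * f \<in> I (Suc k)"
proof -
  have "s * f \<in> I (Suc k)" if "s \<in> lin_comb {h. \<exists>m'. m = Suc m' \<and> h \<in> hom_space n m'} L {0}" for s
    using that
  proof induction
    case (base p)
    then show ?case
      using P_zero P_I by auto
  next
    case (step c l s)
    then have "c * (l * f) \<in> I (Suc k)"
      using R_hom assms(3) by (blast intro: I_mult L_mult_I)
    with step show ?case
      by (simp add: distrib_right I_add mult.assoc)
  qed
  with hom_space_decomp[OF assms(1)] assms(2) show ?thesis
    by auto
qed

section \<open>Arithmetic of the local filtration\<close>

lemma Q_subset_R: "Q k \<subseteq> R"
  by (auto simp: Q_def)

lemma I_Q: "f \<in> R \<Longrightarrow> f \<in> I k \<Longrightarrow> f \<in> Q k"
  by (auto simp: Q_def intro!: bexI[of _ 1] R_one)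

lemma P_Q: "P \<subseteq> Q k"
  using I_Q P_I P_subset by blast

lemma Q_0: "Q 0 = R"
  using I_Q I_0 Q_subset_R by blast

lemma Q_Suc: "Q (Suc k) \<subseteq> Q k"
  using I_Suc by (fastforce simp: Q_def)

text \<open>Elements that are nonzero at \<open>x\<close> are units of the local ring.\<close>

lemma Q_cancel:
  assumes "u \<in> R" "mpoly_eval u x \<noteq> 0" "f \<in> R" "u * f \<in> Q k"
  shows "f \<in> Q k"
proof -
  obtain w where "w \<in> R" "mpoly_eval w x \<noteq> 0" "w * (u * f) \<in> I k"
    using assms(4) by (auto simp: Q_def)
  then show ?thesis
    using assms by (auto simp: Q_def mpoly_eval_mult R_mult mult.assoc intro!: bexI[of _ "w * u"])
qed

lemma Q_mult: "f \<in> Q k \<Longrightarrow> r \<in> R \<Longrightarrow> r * f \<in> Q k"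
  by (auto simp: Q_def R_mult mult.left_commute[of _ r] intro: I_mult)

lemma Q_add:
  assumes "f \<in> Q k" "g \<in> Q k"
  shows "f + g \<in> Q k"
proof -
  obtain u w where "u \<in> R" "mpoly_eval u x \<noteq> 0" "u * f \<in> I k"
    and "w \<in> R" "mpoly_eval w x \<noteq> 0" "w * g \<in> I k"
    using assms by (auto simp: Q_def)
  then have "w * (u * f) + u * (w * g) \<in> I k"
    by (simp add: I_add I_mult)
  then have "(u * w) * (f + g) \<in> I k"
    by (simp add: algebra_simps)
  then show ?thesis
    using assms \<open>u \<in> R\<close> \<open>w \<in> R\<close> \<open>mpoly_eval u x \<noteq> 0\<close> \<open>mpoly_eval w x \<noteq> 0\<close>
    by (auto simp: Q_def R_add mpoly_eval_mult R_mult intro!: bexI[of _ "u * w"])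
qed

lemma subspace_Q: "mp.subspace (Q k)"
proof (rule mp.subspaceI)
  show "smult_mp c f \<in> Q k" if "f \<in> Q k" for c f
    using Q_mult[OF that, of "Poly_Mapping.single 0 c"] by (simp add: smult_mp_eq R_def)
qed (use P_Q P_zero Q_add in auto)

lemma vanish_mult_Q:
  assumes "g \<in> hom_space n m" "mpoly_eval g x = 0" "f \<in> Q k"
  shows "g * f \<in> Q (Suc k)"
proof -
  obtain u where "u \<in> R" "mpoly_eval u x \<noteq> 0" "u * f \<in> I k"
    using assms(3) by (auto simp: Q_def)
  then have "u * (g * f) \<in> I (Suc k)"
    using vanish_mult_I[OF assms(1,2), of "u * f" k] by (simp add: mult_ac)
  then show ?thesis
    using \<open>u \<in> R\<close> \<open>mpoly_eval u x \<noteq> 0\<close> assms R_hom by (auto simp: Q_def R_mult)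
qed

text \<open>Nakayama's lemma at \<open>x\<close>, by eliminating generators one at a time. The
  factors \<open>u\<close> that are nonzero at \<open>x\<close> play the role of denominators in the
  local ring.\<close>

lemma nakayama:
  assumes "finite W" "W \<subseteq> R"
    and "\<And>w. w \<in> W \<Longrightarrow> \<exists>u\<in>R. mpoly_eval u x \<noteq> 0 \<and> u * w \<in> lin_comb {c \<in> R. mpoly_eval c x = 0} W P"
  shows "W \<subseteq> P"
  using assms
proof (induction W rule: finite_induct)
  case (insert w W)
  let ?N = "{c \<in> R. mpoly_eval c x = 0}"
  have N: "0 \<in> ?N" "\<And>c d. c \<in> ?N \<Longrightarrow> d \<in> ?N \<Longrightarrow> c + d \<in> ?N"
    and RN: "\<And>c d. c \<in> R \<Longrightarrow> d \<in> ?N \<Longrightarrow> c * d \<in> ?N"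
    by (auto simp: R_zero R_add mpoly_eval_add R_mult mpoly_eval_mult)
  have add: "r + s \<in> lin_comb ?N W P" if "r \<in> lin_comb ?N W P" "s \<in> lin_comb ?N W P" for r s
    using that by (intro lin_comb_add) (auto simp: P_add P_zero)
  have mult: "c * s \<in> lin_comb ?N W P" if "s \<in> lin_comb ?N W P" "c \<in> R" for c s
    using that RN by (intro lin_comb_mult[of s ?N W P c]) (auto simp: P_mult)
  obtain u where u: "u \<in> R" "mpoly_eval u x \<noteq> 0" "u * w \<in> lin_comb ?N (insert w W) P"
    using insert.prems(2)[of w] by auto
  then obtain c s where c: "c \<in> ?N" and s: "s \<in> lin_comb ?N W P" and uw: "u * w = c * w + s"
    using lin_comb_insertE[OF u(3) N] by blast
  \<comment> \<open>Moving the \<open>w\<close> term to the left leaves a coefficient that is still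
    nonzero at \<open>x\<close>, since \<open>c\<close> vanishes there.\<close>
  define u1 where "u1 = u - c"
  have u1: "u1 \<in> R" "mpoly_eval u1 x \<noteq> 0" "u1 * w \<in> lin_comb ?N W P"
    using u(1,2) c s uw by (auto simp: u1_def R_diff mpoly_eval_diff algebra_simps)
  have "W \<subseteq> P"
  proof (rule insert.IH)
    fix v assume "v \<in> W"
    then obtain y where y: "y \<in> R" "mpoly_eval y x \<noteq> 0" "y * v \<in> lin_comb ?N (insert w W) P"
      using insert.prems(2)[of v] by auto
    then obtain b r where b: "b \<in> ?N" and r: "r \<in> lin_comb ?N W P" and yv: "y * v = b * w + r"
      using lin_comb_insertE[OF y(3) N] by blast
    \<comment> \<open>Multiplying the relation for \<open>v\<close> by \<open>u1\<close> allows
      \<open>w\<close> to be replaced by a combination of the other generators.\<close>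
    have "b * (u1 * w) + u1 * r \<in> lin_comb ?N W P"
      using b r u1 by (intro add mult[of "u1 * w"] mult[of r]) auto
    moreover have "b * (u1 * w) + u1 * r = (u1 * y) * v"
    proof -
      have "(u1 * y) * v = u1 * (b * w + r)"
        by (simp add: mult.assoc flip: yv)
      then show ?thesis
        by (simp add: algebra_simps)
    qed
    ultimately have "(u1 * y) * v \<in> lin_comb ?N W P"
      by metis
    then show "\<exists>u\<in>R. mpoly_eval u x \<noteq> 0 \<and> u * v \<in> lin_comb ?N W P"
      using u1 y by (intro bexI[of _ "u1 * y"]) (auto simp: mpoly_eval_mult R_mult)
  qed (use insert.prems in auto)
  moreover have "lin_comb ?N W P \<subseteq> P" if "W \<subseteq> P"
  proof
    fix s assume "s \<in> lin_comb ?N W P"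
    then show "s \<in> P"
      by induction (use that in \<open>auto simp: P_add P_mult\<close>)
  qed
  ultimately have "u1 * w \<in> P"
    using u1(3) by blast
  \<comment> \<open>Elements of \<open>P\<close> vanish at \<open>x\<close>, so \<open>u1\<close> is
    not in \<open>P\<close> and primality removes it.\<close>
  then have "w \<in> P"
    using P_prime[of u1 w] u1(1,2) insert.prems(1) vanish by auto
  with \<open>W \<subseteq> P\<close> show ?case
    by simp
qed simp

text \<open>Otherwise two consecutive powers agree locally, Nakayama's lemma puts \<open>V k\<close>
  and with it every \<open>l ^ k\<close> into \<open>P\<close>, and primality then gives
  \<open>L \<subseteq> P\<close>. So the filtration never becomes stationary.\<close>

lemma V_not_subset_Q:
  assumes "\<not> L \<subseteq> P"
  shows "\<not> V k \<subseteq> Q (Suc k)"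
proof
  assume V: "V k \<subseteq> Q (Suc k)"
  \<comment> \<open>One factor of each product in \<open>V (Suc k)\<close> is moved into the
    coefficient, which then vanishes at \<open>x\<close>.\<close>
  have sub: "I (Suc k) \<subseteq> lin_comb {c \<in> R. mpoly_eval c x = 0} (V k) P"
  proof
    fix f assume "f \<in> I (Suc k)"
    then show "f \<in> lin_comb {c \<in> R. mpoly_eval c x = 0} (V k) P"
      unfolding I_def
    proof induction
      case (step c v s)
      then obtain l w where "l \<in> L" "w \<in> V k" "v = l * w"
        by auto
      with step have "(c * l) * w + s \<in> lin_comb {c \<in> R. mpoly_eval c x = 0} (V k) P"
        by (intro lin_comb.step) (auto simp: R_mult L_R mpoly_eval_mult L_def R_hom)
      then show ?case
        by (simp add: \<open>v = l * w\<close> mult.assoc)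
    qed (auto intro: lin_comb.base)
  qed
  have "V k \<subseteq> P"
  proof (rule nakayama)
    show "V k \<subseteq> R"
      using V Q_subset_R by blast
    show "\<exists>u\<in>R. mpoly_eval u x \<noteq> 0 \<and> u * w \<in> lin_comb {c \<in> R. mpoly_eval c x = 0} (V k) P"
      if "w \<in> V k" for w
      using that V sub by (fastforce simp: Q_def)
  qed (rule finite_V)
  have "l \<in> P" if "l \<in> L" for l
    using power_in_V[OF that, of k] \<open>V k \<subseteq> P\<close> L_R[OF that] by (intro P_power[of l k]) auto
  with assms show False
    by blast
qed

text \<open>Starting from all forms of degree \<open>m\<close>, one dimension is dropped at a time
  while staying between two consecutive steps of the filtration. This realises an ideal of colength
  \<open>j\<close> in a single degree.\<close>

lemma exists_osculating_subspace:
  assumes "\<not> L \<subseteq> P" "j \<le> m"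
  shows "\<exists>J k. mp.subspace J \<and> k \<le> j \<and> Q (Suc k) \<inter> hom_space n m \<subseteq> J \<and> J \<subseteq> Q k \<inter> hom_space n m \<and>
    card (hom_space n m :: 'a mpoly set) = CARD('a) ^ j * card J"
  using assms(2)
proof (induction j)
  case 0
  have "Q 0 \<inter> hom_space n m = hom_space n m"
    using Q_0 R_hom by blast
  then show ?case
    using Q_Suc[of 0] by (intro exI[of _ "hom_space n m"] exI[of _ 0]) (auto simp: subspace_hom_space)
next
  case (Suc j)
  then obtain J k where J: "mp.subspace J" "k \<le> j" "Q (Suc k) \<inter> hom_space n m \<subseteq> J" "J \<subseteq> Q k \<inter> hom_space n m"
    "card (hom_space n m :: 'a mpoly set) = CARD('a) ^ j * card J"
    by auto
  have fin: "finite J"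
    using J(4) finite_hom_space[of n m] by (meson Int_lower2 finite_subset)
  have sub: "mp.subspace (Q i \<inter> hom_space n m)" for i
    by (intro mp.subspace_inter subspace_Q subspace_hom_space)
  show ?case
  proof (cases "J = Q (Suc k) \<inter> hom_space n m")
    case False
    then obtain U where "mp.subspace U" "Q (Suc k) \<inter> hom_space n m \<subseteq> U" "U \<subseteq> J" "card J = CARD('a) * card U"
      using mp.exists_subspace_index_card[OF finite fin J(1) sub[of "Suc k"]] J(3) by blast
    then show ?thesis
      using J by (intro exI[of _ U] exI[of _ k]) auto
  next
    case True
    \<comment> \<open>\<open>J\<close> has reached the lower step, so the next pair of steps takes
      over. A product outside the following step, padded by a power of \<open>t\<close> to degree
      \<open>m\<close>, shows that the inclusion is again strict; the padding exists because
      \<open>k \<le> j\<close> and \<open>Suc j \<le> m\<close>.\<close>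
    obtain v where v: "v \<in> V (Suc k)" "v \<notin> Q (Suc (Suc k))"
      using V_not_subset_Q[OF assms(1), of "Suc k"] by blast
    have vR: "v \<in> R"
      using v V_hom R_hom by blast
    define f where "f = t ^ (m - Suc k) * v"
    have "f \<in> hom_space n m"
      using hom_space_mult[OF t_power[of "m - Suc k"], of v "Suc k"] v V_hom[of "Suc k"] J(2) Suc.prems
      by (auto simp: f_def)
    moreover have "v \<in> I (Suc k)"
      using v(1) by (rule V_I)
    then have "f \<in> Q (Suc k)"
      unfolding f_def using vR by (intro Q_mult I_Q R_power t_R)
    moreover have "f \<notin> Q (Suc (Suc k))"
      unfolding f_def using v vR t Q_cancel[of "t ^ (m - Suc k)" v "Suc (Suc k)"]
      by (auto simp: R_power t_R mpoly_eval_power)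
    ultimately have "Q (Suc (Suc k)) \<inter> hom_space n m \<subset> J"
      using True Q_Suc[of "Suc k"] by blast
    then obtain U where "mp.subspace U" "Q (Suc (Suc k)) \<inter> hom_space n m \<subseteq> U" "U \<subseteq> J" "card J = CARD('a) * card U"
      using mp.exists_subspace_index_card[OF finite fin J(1) sub[of "Suc (Suc k)"]] by blast
    then show ?thesis
      using J True by (intro exI[of _ U] exI[of _ "Suc k"]) auto
  qed
qed

section \<open>Contact of linear forms with the curve at one point\<close>

lemma Q_antimono: "i \<le> j \<Longrightarrow> Q j \<subseteq> Q i"
  using Q_Suc by (rule lift_Suc_antimono_le)

text \<open>\<open>A\<close> is the preimage of \<open>J\<close> under multiplication by
  \<open>t ^ m\<close>, so its codimension is at most \<open>j\<close>; its members are linear forms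
  with contact at least \<open>j\<close> at \<open>x\<close>. Since \<open>J\<close> lies between
  consecutive steps of the filtration, testing \<open>l\<close> against \<open>t ^ m\<close> alone
  suffices for all products \<open>l * g\<close>.\<close>

lemma exists_contact_space:
  assumes "\<not> L \<subseteq> P" "j \<le> Suc m"
  shows "\<exists>J A. mp.subspace J \<and> J \<subseteq> hom_space n (Suc m) \<and> Q (Suc j) \<inter> hom_space n (Suc m) \<subseteq> J \<and>
    card (hom_space n (Suc m) :: 'a mpoly set) = CARD('a) ^ j * card J \<and>
    A \<subseteq> hom_space n 1 \<and> P \<inter> hom_space n 1 \<subseteq> A \<and>
    card (hom_space n 1 :: 'a mpoly set) \<le> CARD('a) ^ j * card A \<and>
    (\<forall>l\<in>A. \<forall>g\<in>hom_space n m. l * g \<in> J)"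
proof -
  obtain J k where J: "mp.subspace J" "k \<le> j" "Q (Suc k) \<inter> hom_space n (Suc m) \<subseteq> J"
    "J \<subseteq> Q k \<inter> hom_space n (Suc m)" "card (hom_space n (Suc m) :: 'a mpoly set) = CARD('a) ^ j * card J"
    using exists_osculating_subspace[OF assms] by blast
  define A where "A = {l \<in> hom_space n 1. l * t ^ m \<in> J}"
  have *: "l * t ^ m \<in> hom_space n (Suc m)" if "l \<in> hom_space n 1" for l
    using hom_space_mult[OF that t_power[of m]] by simp
  have "card (hom_space n 1 :: 'a mpoly set) * card J \<le> card A * card (hom_space n (Suc m) :: 'a mpoly set)"
    unfolding A_def using J *
    by (intro card_vimage_subgroup_ge finite_hom_space mp.subspace_add_subgroup subspace_hom_space)
      (auto simp: algebra_simps)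
  then have "card (hom_space n 1 :: 'a mpoly set) * card J \<le> (CARD('a) ^ j * card A) * card J"
    by (simp add: J(5) mult_ac)
  moreover have "card J > 0"
    using J(4) mp.subspace_0[OF J(1)] finite_hom_space[of n "Suc m"] finite_subset
    by (metis Int_lower2 card_gt_0_iff empty_iff subset_trans)
  ultimately have "card (hom_space n 1 :: 'a mpoly set) \<le> CARD('a) ^ j * card A"
    by simp
  moreover have "P \<inter> hom_space n 1 \<subseteq> A"
  proof
    fix l assume l: "l \<in> P \<inter> hom_space n 1"
    then have "t ^ m * l \<in> P"
      by (intro P_mult R_power t_R) auto
    with l show "l \<in> A"
      using * P_Q[of "Suc k"] J(3) by (auto simp: A_def mult.commute)
  qed
  moreover have "l * g \<in> J" if "l \<in> A" "g \<in> hom_space n m" for l g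
  proof -
    \<comment> \<open>Multiplying by the part of \<open>g\<close> vanishing at \<open>x\<close> pushes \<open>l\<close> into the next step of the filtration.\<close>
    define g' where "g' = g - smult_mp (mpoly_eval g x) (t ^ m)"
    have g': "g' \<in> hom_space n m" "mpoly_eval g' x = 0"
      using that t t_power by (simp_all add: g'_def hom_space_diff hom_space_smult mpoly_eval_diff mpoly_eval_power)
    have lJ: "l * t ^ m \<in> J" and l: "l \<in> hom_space n 1"
      using that by (auto simp: A_def)
    have "l \<in> Q k"
      using lJ J(4) Q_cancel[of "t ^ m" l k] R_hom[OF l] t
      by (auto simp: R_power t_R mpoly_eval_power mult.commute)
    then have "g' * l \<in> Q (Suc k)"
      using g' by (intro vanish_mult_Q)
    moreover have "g' * l \<in> hom_space n (Suc m)"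
      using hom_space_mult[OF g'(1) l] by simp
    ultimately have "g' * l \<in> J"
      using J(3) by blast
    then have "smult_mp (mpoly_eval g x) (l * t ^ m) + g' * l \<in> J"
      using J(1) lJ by (simp add: mp.subspace_add mp.subspace_scale)
    moreover have "smult_mp (mpoly_eval g x) (l * t ^ m) + g' * l = l * g"
      by (simp add: g'_def smult_mp_eq algebra_simps)
    ultimately show ?thesis
      by metis
  qed
  \<comment> \<open>The step \<open>k\<close> at which \<open>J\<close> sits is only known to be at
    most \<open>j\<close>; passing to \<open>Suc j\<close> gives a depth fixed in advance.\<close>
  moreover have "Q (Suc j) \<inter> hom_space n (Suc m) \<subseteq> J"
    using J(2,3) Q_antimono[of "Suc k" "Suc j"] by auto
  moreover have "J \<subseteq> hom_space n (Suc m)" "A \<subseteq> hom_space n 1"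
    using J(4) by (auto simp: A_def)
  ultimately show ?thesis
    using J(1,5) by (intro exI[of _ J] exI[of _ A] conjI ballI)
qed

text \<open>A form that is nonzero at \<open>x\<close> is invertible modulo every power of the ideal
  of \<open>x\<close>. In graded form this needs room for the degree of \<open>g\<close> and for
  \<open>k\<close> linear factors; the induction improves the remainder by one power at a
  time.\<close>

lemma comaximal:
  assumes g: "g \<in> hom_space n a" "mpoly_eval g x \<noteq> 0" and f: "f \<in> hom_space n m" and "a + k \<le> m"
  shows "\<exists>h\<in>hom_space n (m - a). f - g * h \<in> lin_comb (hom_space n (m - k)) (V k) {0}"
  using assms(4)
proof (induction k)
  case 0
  show ?case
    using f lin_comb.step[of f "hom_space n m" 1 "V 0" 0 "{0}"] mp.subspace_0[OF subspace_hom_space]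
    by (intro bexI[of _ 0]) (auto intro: lin_comb.base)
next
  case (Suc k)
  let ?D = "lin_comb (hom_space n (m - Suc k)) (V (Suc k)) {0}"
  note add = mp.subspace_add[OF subspace_hom_space, of _ n "m - a"]
  have "\<exists>h\<in>hom_space n (m - a). s - g * h \<in> ?D"
    if "s \<in> lin_comb (hom_space n (m - k)) (V k) {0}" for s
    using that
  proof induction
    case (base p)
    then show ?case
      using mp.subspace_0[OF subspace_hom_space] by (intro bexI[of _ 0]) (auto intro: lin_comb.base)
  next
    case (step c v s)
    then obtain h where h: "h \<in> hom_space n (m - a)" "s - g * h \<in> ?D"
      by blast
    \<comment> \<open>The exponent \<open>e\<close> brings \<open>g\<close> to the degree of the
      coefficient \<open>c\<close>, and \<open>b\<close> matches the values at \<open>x\<close>. So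
      \<open>c'\<close> vanishes at \<open>x\<close> and supplies a further factor from
      \<open>L\<close>, while the part taken off \<open>c\<close> is a multiple of
      \<open>g\<close>.\<close>
    define e where "e = m - k - a"
    have m: "m - k = Suc (m - Suc k)" "a + e = m - k" "e + k = m - a"
      using Suc.prems by (auto simp: e_def)
    define b where "b = mpoly_eval c x / mpoly_eval g x"
    define c' where "c' = c - smult_mp b (g * t ^ e)"
    have "g * t ^ e \<in> hom_space n (m - k)"
      using hom_space_mult[OF g(1) t_power[of e]] m by simp
    then have "c' \<in> hom_space n (m - k)"
      using step.hyps unfolding c'_def by (intro hom_space_diff hom_space_smult)
    moreover have "mpoly_eval c' x = 0"
      using g t by (simp add: c'_def b_def mpoly_eval_diff mpoly_eval_mult mpoly_eval_power)
    ultimately have "c' \<in> lin_comb (hom_space n (m - Suc k)) L {0}"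
      using hom_space_vanish[of c' "m - Suc k"] m(1) by simp
    then have "v * c' \<in> ?D"
    proof (rule lin_comb_image)
      fix d l :: "'a mpoly" assume "d \<in> hom_space n (m - Suc k)" "l \<in> L"
      with \<open>v \<in> V k\<close> show "\<exists>d'\<in>hom_space n (m - Suc k). \<exists>v'\<in>V (Suc k). v * (d * l) = d' * v'"
        by (intro bexI[of _ d] bexI[of _ "l * v"]) (auto simp: mult_ac)
    qed simp
    then have "v * c' + (s - g * h) \<in> ?D"
      using h(2) by (intro lin_comb_add) auto
    moreover have "v * c' + (s - g * h) = (c * v + s) - g * (smult_mp b (t ^ e * v) + h)"
      by (simp add: c'_def smult_mp_eq algebra_simps)
    moreover have "t ^ e * v \<in> hom_space n (m - a)"
      using hom_space_mult[OF t_power[of e], of v k] V_hom[of k] step.hyps m(3) by auto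
    then have "smult_mp b (t ^ e * v) + h \<in> hom_space n (m - a)"
      using h(1) by (intro add hom_space_smult)
    ultimately show ?case
      by metis
  qed
  moreover obtain h where h: "h \<in> hom_space n (m - a)" "f - g * h \<in> lin_comb (hom_space n (m - k)) (V k) {0}"
    using Suc by auto
  ultimately obtain h' where h': "h' \<in> hom_space n (m - a)" "(f - g * h) - g * h' \<in> ?D"
    by blast
  then show ?case
    using h(1) add[of h h'] by (intro bexI[of _ "h + h'"]) (auto simp: algebra_simps)
qed

lemma lin_comb_V_subset_Q: "lin_comb (hom_space n i) (V k) {0} \<subseteq> Q k"
proof
  fix f assume f: "f \<in> lin_comb (hom_space n i) (V k) {0}"
  then have "f \<in> I k"
    unfolding I_def using lin_comb_mono[of "hom_space n i" R "V k" "V k" "{0}" P] R_hom P_zero by blast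
  moreover have "f \<in> R"
    using f
  proof induction
    case (step c v s)
    then show ?case
      using V_hom R_hom by (blast intro: R_add R_mult)
  qed (simp add: R_zero)
  ultimately show "f \<in> Q k"
    by (rule I_Q[rotated])
qed

end

subsection \<open>Contact with hyperplanes\<close>

lemma field_card_ge_2: "2 \<le> CARD('a::{finite,field})"
proof -
  have "card {0, 1 :: 'a} \<le> CARD('a)"
    by (intro card_mono) auto
  then show ?thesis
    by simp
qed

lemma (in rational_point) power_in_Q: "l \<in> L \<Longrightarrow> l ^ k \<in> Q k"
  by (intro I_Q V_I power_in_V R_power L_R)

section \<open>Hilbert function and hyperplane sections\<close>

context homog_prime
begin

abbreviation S :: "nat \<Rightarrow> 'a mpoly set" where "S \<equiv> hom_space n"

text \<open>Since \<open>P \<inter> S m\<close> lies in \<open>S m\<close>, the subtraction of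
  natural numbers in \<open>hilbert_fn\<close> never truncates, and the Hilbert function is the
  exponent of an index.\<close>

lemma card_hom_space_eq: "card (S m) = CARD('a) ^ hilbert_fn n P m * card (P \<inter> S m)"
proof -
  have S: "card (S m) = CARD('a) ^ mp.dim (S m)"
    by (intro mp.card_subspace finite subspace_hom_space finite_hom_space)
  have P: "card (P \<inter> S m) = CARD('a) ^ mp.dim (P \<inter> S m)"
    by (intro mp.card_subspace finite subspace_P_hom finite_Int disjI2 finite_hom_space)
  have "card (P \<inter> S m) \<le> card (S m)"
    by (intro card_mono finite_hom_space) auto
  then have "mp.dim (P \<inter> S m) \<le> mp.dim (S m)"
    using field_card_ge_2[where 'a = 'a] by (simp add: S P)
  then show ?thesis
    unfolding S P hilbert_fn_def by (simp flip: power_add)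
qed

lemma card_P_hom_pos: "card (P \<inter> S m) > 0"
  using finite_hom_space[of n m] mp.subspace_0[OF subspace_P_hom] by (auto simp: card_gt_0_iff)

text \<open>The set counted is the degree \<open>k\<close> part of the ideal generated by
  \<open>l\<close> and \<open>P\<close>. By primality \<open>l * s + p = 0\<close> forces
  \<open>s\<close> into \<open>P\<close>, so the kernel is a copy of \<open>P \<inter> S m\<close>.
  The index in \<open>S k\<close> is thus governed by the difference of two Hilbert values.\<close>

lemma card_hyperplane_section:
  assumes l: "l \<in> S 1" "l \<notin> P" and k: "k = Suc m"
  shows "card ((\<lambda>(s, p). l * s + p) ` (S m \<times> (P \<inter> S k))) = CARD('a) ^ hilbert_fn n P m * card (P \<inter> S k)"
proof -
  have lS: "l * s \<in> S k" if "s \<in> S m" for s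
    using hom_space_mult[OF l(1) that] k by simp
  have "{z \<in> S m \<times> (P \<inter> S k). (\<lambda>(s, p). l * s + p) z = 0} = (\<lambda>s. (s, - (l * s))) ` (P \<inter> S m)"
  proof (intro equalityI subsetI)
    fix z assume "z \<in> {z \<in> S m \<times> (P \<inter> S k). (\<lambda>(s, p). l * s + p) z = 0}"
    then obtain s p where z: "z = (s, p)" "s \<in> S m" "p \<in> P" "l * s + p = 0"
      by auto
    then have p: "p = - (l * s)"
      by (simp add: eq_neg_iff_add_eq_0 add.commute)
    then have "l * s \<in> P"
      using P_diff[OF P_zero z(3)] by simp
    then have "s \<in> P"
      using P_prime[of l s] l z(2) R_hom by blast
    with z p show "z \<in> (\<lambda>s. (s, - (l * s))) ` (P \<inter> S m)"
      by blast
  next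
    fix z assume "z \<in> (\<lambda>s. (s, - (l * s))) ` (P \<inter> S m)"
    then obtain s where s: "s \<in> P" "s \<in> S m" "z = (s, - (l * s))"
      by auto
    have "l * s \<in> P \<inter> S k"
      using s l lS P_mult[of s l] R_hom by blast
    then have "- (l * s) \<in> P \<inter> S k"
      using mp.subspace_neg[OF subspace_P_hom] by blast
    with s show "z \<in> {z \<in> S m \<times> (P \<inter> S k). (\<lambda>(s, p). l * s + p) z = 0}"
      by simp
  qed
  then have ker: "card {z \<in> S m \<times> (P \<inter> S k). (\<lambda>(s, p). l * s + p) z = 0} = card (P \<inter> S m)"
    by (simp add: card_image inj_on_def)
  have "add_subgroup (S m \<times> (P \<inter> S k))"
    using mp.subspace_add_subgroup[OF subspace_hom_space[of n m]] mp.subspace_add_subgroup[OF subspace_P_hom[of k]]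
    by (auto simp: add_subgroup_def zero_prod_def)
  then have "card (S m \<times> (P \<inter> S k)) =
      card ((\<lambda>(s, p). l * s + p) ` (S m \<times> (P \<inter> S k))) * card (P \<inter> S m)"
    unfolding ker[symmetric]
    by (rule card_image_times_kernel) (auto simp: finite_hom_space algebra_simps)
  then show ?thesis
    using card_P_hom_pos[of m] by (simp add: card_cartesian_product card_hom_space_eq[of m])
qed

end

section \<open>Consequences of the linear Hilbert polynomial\<close>

locale proj_curve = homog_prime n P for n :: nat and P :: "'a::{finite,field} mpoly set" +
  fixes d :: nat
  assumes curve: "proj_curve_deg n P d"
begin

lemma hilbert_fn_linear:
  obtains M c where "\<And>m. m \<ge> M \<Longrightarrow> int (hilbert_fn n P m) = int d * int m + c"
  using curve unfolding proj_curve_deg_def eventually_sequentially by blast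

lemma d_pos: "d > 0"
  using curve by (simp add: proj_curve_deg_def)

lemma hilbert_fn_unbounded: "\<exists>m. hilbert_fn n P m > b"
proof -
  obtain M c where M: "\<And>m. m \<ge> M \<Longrightarrow> int (hilbert_fn n P m) = int d * int m + c"
    using hilbert_fn_linear by blast
  define m where "m = M + nat (int b + 1 - c)"
  have "int m \<ge> int b + 1 - c"
    by (simp add: m_def)
  moreover have "int d * int m \<ge> 1 * int m"
    using d_pos by (intro mult_right_mono) auto
  ultimately have "int (hilbert_fn n P m) > int b"
    using M[of m] by (simp add: m_def)
  then show ?thesis
    by auto
qed

text \<open>Otherwise every form is, modulo \<open>P\<close>, its value times \<open>t ^ m\<close>,
  and the Hilbert function is at most 1, as for a single point.\<close>

lemma tangent_forms_not_subset:
  assumes "rational_point n P x t"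
  shows "\<not> rational_point.L n x \<subseteq> P"
proof
  interpret rational_point n P x t by fact
  assume L: "L \<subseteq> P"
  obtain m where m: "hilbert_fn n P m > 1"
    using hilbert_fn_unbounded by blast
  have "S m \<subseteq> (\<lambda>(c, p). smult_mp c (t ^ m) + p) ` (UNIV \<times> (P \<inter> S m))"
  proof
    fix g assume g: "g \<in> S m"
    obtain s where s: "s \<in> lin_comb {h. \<exists>m'. m = Suc m' \<and> h \<in> S m'} L {0}"
      "g = smult_mp (mpoly_eval g x) (t ^ m) + s"
      using hom_space_decomp[OF g] by blast
    have "s \<in> P"
      using s(1) by induction (use L P_zero in \<open>auto intro!: P_add P_mult intro: R_hom\<close>)
    moreover have "s = g - smult_mp (mpoly_eval g x) (t ^ m)"
      by (subst s(2)) simp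
    then have "s \<in> S m"
      using g t_power[of m] by (simp add: hom_space_diff hom_space_smult)
    ultimately show "g \<in> (\<lambda>(c, p). smult_mp c (t ^ m) + p) ` (UNIV \<times> (P \<inter> S m))"
      using s(2) by force
  qed
  then have "card (S m) \<le> card ((UNIV :: 'a set) \<times> (P \<inter> S m))"
    by (rule surj_card_le[rotated]) (simp add: finite_hom_space)
  then have "CARD('a) ^ hilbert_fn n P m \<le> CARD('a)"
    using card_P_hom_pos[of m] by (simp add: card_hom_space_eq card_cartesian_product)
  moreover have "CARD('a) ^ 1 < CARD('a) ^ hilbert_fn n P m"
    using m field_card_ge_2[where 'a = 'a] by (intro power_strict_increasing) auto
  ultimately show False
    by simp
qed

end

text \<open>A finite family of pairwise distinct rational points, given by representing vectors;
  \<open>T x\<close> is a linear form normalised at \<open>x\<close>.\<close>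
locale curve_points = proj_curve n P d for n :: nat and P :: "'a::{finite,field} mpoly set" and d +
  fixes X :: "(nat \<Rightarrow> 'a) set" and T :: "(nat \<Rightarrow> 'a) \<Rightarrow> 'a mpoly"
  assumes finite_X: "finite X"
    and points: "x \<in> X \<Longrightarrow> rational_point n P x (T x)"
    and supported: "x \<in> X \<Longrightarrow> \<forall>i>n. x i = 0"
    and separated: "x \<in> X \<Longrightarrow> y \<in> X \<Longrightarrow> x \<noteq> y \<Longrightarrow> \<exists>l\<in>hom_space n 1. mpoly_eval l y = 0 \<and> mpoly_eval l x \<noteq> 0"
begin

text \<open>Chinese remainder theorem in one degree: conditions at distinct points are independent
  once \<open>m\<close> leaves room for \<open>Suc K\<close> linear factors per point and
  \<open>Suc K\<close> more. Hence the indices multiply.\<close>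

lemma card_Inter_contact:
  assumes m: "card X * Suc K + Suc K \<le> m"
    and J: "\<And>x. x \<in> X \<Longrightarrow> mp.subspace (J x)" "\<And>x. x \<in> X \<Longrightarrow> J x \<subseteq> S m"
      "\<And>x. x \<in> X \<Longrightarrow> rational_point.Q n P x (Suc K) \<inter> S m \<subseteq> J x"
      "\<And>x. x \<in> X \<Longrightarrow> card (S m) = CARD('a) ^ e x * card (J x)"
    and "Y \<subseteq> X"
  shows "card (S m) = CARD('a) ^ (\<Sum>x\<in>Y. e x) * card (S m \<inter> (\<Inter>x\<in>Y. J x))"
  using finite_subset[OF \<open>Y \<subseteq> X\<close> finite_X] \<open>Y \<subseteq> X\<close>
proof (induction Y rule: finite_induct)
  case (insert x Y)
  let ?U = "S m \<inter> (\<Inter>y\<in>Y. J y)"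
  interpret rational_point n P x "T x"
    using insert.prems points by blast
  have "\<forall>y\<in>Y. \<exists>l. l \<in> S 1 \<and> mpoly_eval l y = 0 \<and> mpoly_eval l x \<noteq> 0"
    using insert separated by blast
  then obtain l where l: "\<And>y. y \<in> Y \<Longrightarrow> l y \<in> S 1 \<and> mpoly_eval (l y) y = 0 \<and> mpoly_eval (l y) x \<noteq> 0"
    by metis
  \<comment> \<open>\<open>g\<close> vanishes to order at least \<open>Suc K\<close> at each earlier
    point but is nonzero at the new point \<open>x\<close>.\<close>
  define g where "g = (\<Prod>y\<in>Y. l y ^ Suc K)"
  have mY: "card Y * Suc K + Suc K \<le> m"
  proof -
    have "card Y \<le> card X"
      using insert.prems finite_X by (intro card_mono) auto
    then have "card Y * Suc K \<le> card X * Suc K"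
      by (rule mult_le_mono1)
    with m show ?thesis by simp
  qed
  have gS: "g \<in> S (card Y * Suc K)"
    unfolding g_def using l insert.hyps by (intro hom_space_prod hom_space_power1) auto
  have "mpoly_eval g x = (\<Prod>y\<in>Y. mpoly_eval (l y ^ Suc K) x)"
    unfolding g_def using insert.hyps(1)
    by (induction Y rule: finite_induct) (simp_all only: prod.empty prod.insert mpoly_eval_one mpoly_eval_mult not_False_eq_True)
  then have gx: "mpoly_eval g x \<noteq> 0"
    using l insert.hyps(1) by (simp add: mpoly_eval_power mpoly_eval_mult)
  have sub_U: "mp.subspace ?U"
    using J(1) insert.prems by (intro mp.subspace_inter mp.subspace_Inter subspace_hom_space) auto
  have "sumset ?U (J x) = S m"
  proof
    show "sumset ?U (J x) \<subseteq> S m"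
      using J(2)[of x] insert.prems mp.subspace_add[OF subspace_hom_space[of n m]] by (fastforce simp: sumset_def)
    show "S m \<subseteq> sumset ?U (J x)"
    proof
      fix f assume f: "f \<in> S m"
      \<comment> \<open>This splits \<open>f\<close> into a multiple of \<open>g\<close>, which
        meets all earlier conditions, and a remainder that meets the condition at
        \<open>x\<close>.\<close>
      obtain h where h: "h \<in> S (m - card Y * Suc K)"
        "f - g * h \<in> lin_comb (S (m - Suc K)) (V (Suc K)) {0}"
        using comaximal[OF gS gx f mY] by blast
      have gh: "g * h \<in> S m"
        using hom_space_mult[OF gS h(1)] mY by simp
      have "g * h \<in> J y" if y: "y \<in> Y" for y
      proof -
        interpret y: rational_point n P y "T y"
          using insert.prems points y by blast
        have "g = l y ^ Suc K * (\<Prod>z\<in>Y - {y}. l z ^ Suc K)"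
          unfolding g_def using insert.hyps(1) y by (rule prod.remove)
        moreover have "l y ^ Suc K \<in> y.Q (Suc K)"
          using l[OF y] by (intro y.power_in_Q) (simp add: y.L_def)
        moreover have "(\<Prod>z\<in>Y - {y}. l z ^ Suc K) * h \<in> R"
          using l insert.hyps(1) h(1)
          by (intro R_mult R_hom[OF h(1)] R_hom[OF hom_space_prod[of _ _ _ "Suc K"]] hom_space_power1) auto
        ultimately have "g * h \<in> y.Q (Suc K)"
          using y.Q_mult[of "l y ^ Suc K" "Suc K" "(\<Prod>z\<in>Y - {y}. l z ^ Suc K) * h"]
          by (simp only: mult_ac)
        then show ?thesis
          using gh J(3)[of y] insert.prems y by auto
      qed
      then have "g * h \<in> ?U"
        using gh by blast
      moreover have "f - g * h \<in> J x"
        using J(3)[of x] insert.prems lin_comb_V_subset_Q h(2) hom_space_diff[OF f gh] by blast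
      ultimately have "(\<lambda>(a, b). a + b) (g * h, f - g * h) \<in> sumset ?U (J x)"
        unfolding sumset_def by blast
      then show "f \<in> sumset ?U (J x)"
        by simp
    qed
  qed
  moreover have "card (sumset ?U (J x)) * card (?U \<inter> J x) = card ?U * card (J x)"
  proof (rule card_sumset)
    show "finite (J x)"
      using J(2)[of x] insert.prems finite_subset[OF _ finite_hom_space] by auto
    show "add_subgroup (J x)"
      using J(1) insert.prems by (intro mp.subspace_add_subgroup) auto
    show "add_subgroup ?U"
      using sub_U by (rule mp.subspace_add_subgroup)
    show "finite ?U"
      by (simp add: finite_hom_space)
  qed
  ultimately have "card (S m) * card (?U \<inter> J x) = card ?U * card (J x)"
    by simp
  moreover have "card (S m) = CARD('a) ^ e x * card (J x)"
    using J(4) insert.prems by simp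
  moreover have "card (J x) > 0"
    using J(1,2)[of x] insert.prems mp.subspace_0[of "J x"] finite_subset[OF _ finite_hom_space]
    by (auto simp: card_gt_0_iff)
  ultimately have "CARD('a) ^ e x * card (?U \<inter> J x) = card ?U"
    by simp
  moreover have "S m \<inter> (\<Inter>y\<in>insert x Y. J y) = ?U \<inter> J x"
    by blast
  moreover have "card (S m) = CARD('a) ^ (\<Sum>y\<in>Y. e y) * card ?U"
    using insert by simp
  moreover have "(\<Sum>y\<in>insert x Y. e y) = (\<Sum>y\<in>Y. e y) + e x"
    using insert.hyps by simp
  ultimately show ?case
    by (simp only: power_add mult.assoc)
qed simp

text \<open>Bezout in terms of indices: the ideal generated by \<open>l\<close> and \<open>P\<close>
  has index \<open>CARD('a) ^ d\<close> in degree \<open>Suc m\<close>, and there it lies in the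
  intersection of the contact spaces, whose index is \<open>CARD('a)\<close> to the total
  contact.\<close>

lemma contact_count:
  fixes K :: nat
  obtains A where "\<And>x j. x \<in> X \<Longrightarrow> j \<le> K \<Longrightarrow> A x j \<subseteq> S 1 \<and> P \<inter> S 1 \<subseteq> A x j \<and>
      card (S 1) \<le> CARD('a) ^ j * card (A x j)"
    and "\<And>l. l \<in> S 1 \<Longrightarrow> l \<notin> P \<Longrightarrow> (\<Sum>x\<in>X. card {j \<in> {1..K}. l \<in> A x j}) \<le> d"
proof -
  obtain M c where M: "\<And>m. m \<ge> M \<Longrightarrow> int (hilbert_fn n P m) = int d * int m + c"
    using hilbert_fn_linear by blast
  \<comment> \<open>Large enough for the Hilbert function to be linear, for the contact spaces up to
    \<open>K\<close> to exist, and for the conditions at all points to be independent.\<close>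
  define m where "m = M + card X * Suc K + Suc K"
  have "\<forall>x\<in>X. \<forall>j\<in>{..K}. \<exists>J A. mp.subspace J \<and> J \<subseteq> S (Suc m) \<and>
      rational_point.Q n P x (Suc j) \<inter> S (Suc m) \<subseteq> J \<and>
      card (S (Suc m)) = CARD('a) ^ j * card J \<and> A \<subseteq> S 1 \<and> P \<inter> S 1 \<subseteq> A \<and>
      card (S 1) \<le> CARD('a) ^ j * card A \<and> (\<forall>l\<in>A. \<forall>g\<in>S m. l * g \<in> J)"
  proof (intro ballI)
    fix x j assume "x \<in> X" "j \<in> {..K}"
    then show "\<exists>J A. mp.subspace J \<and> J \<subseteq> S (Suc m) \<and>
      rational_point.Q n P x (Suc j) \<inter> S (Suc m) \<subseteq> J \<and>
      card (S (Suc m)) = CARD('a) ^ j * card J \<and> A \<subseteq> S 1 \<and> P \<inter> S 1 \<subseteq> A \<and>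
      card (S 1) \<le> CARD('a) ^ j * card A \<and> (\<forall>l\<in>A. \<forall>g\<in>S m. l * g \<in> J)"
      using rational_point.exists_contact_space[OF points tangent_forms_not_subset[OF points], of x j m]
      by (simp add: m_def)
  qed
  then obtain J A where JA: "\<And>x j. x \<in> X \<Longrightarrow> j \<le> K \<Longrightarrow> mp.subspace (J x j) \<and> J x j \<subseteq> S (Suc m) \<and>
      rational_point.Q n P x (Suc j) \<inter> S (Suc m) \<subseteq> J x j \<and>
      card (S (Suc m)) = CARD('a) ^ j * card (J x j) \<and> A x j \<subseteq> S 1 \<and> P \<inter> S 1 \<subseteq> A x j \<and>
      card (S 1) \<le> CARD('a) ^ j * card (A x j) \<and> (\<forall>l\<in>A x j. \<forall>g\<in>S m. l * g \<in> J x j)"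
    unfolding atMost_iff Ball_def by metis
  have "(\<Sum>x\<in>X. card {j \<in> {1..K}. l \<in> A x j}) \<le> d" if l: "l \<in> S 1" "l \<notin> P" for l
  proof -
    \<comment> \<open>The spaces \<open>A x j\<close> come from separate choices for each
      \<open>j\<close> and are not known to be nested. The largest \<open>j\<close> with
      \<open>l \<in> A x j\<close> still bounds the number of such \<open>j\<close> from 1 to
      \<open>K\<close>.\<close>
    define e where "e x = Max {j \<in> {..K}. l \<in> A x j}" for x
    have e: "e x \<le> K" "l \<in> A x (e x)" "card {j \<in> {1..K}. l \<in> A x j} \<le> e x" if x: "x \<in> X" for x
    proof -
      \<comment> \<open>Contact 0 imposes no condition, so the maximum is over a nonempty
        set.\<close>
      have "A x 0 = S 1"
        using JA[OF x, of 0] finite_hom_space[of n 1] by (intro card_seteq) auto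
      then have "0 \<in> {j \<in> {..K}. l \<in> A x j}"
        using l by simp
      then have "e x \<in> {j \<in> {..K}. l \<in> A x j}"
        unfolding e_def by (intro Max_in) auto
      then show "e x \<le> K" "l \<in> A x (e x)"
        by auto
      have "{j \<in> {1..K}. l \<in> A x j} \<subseteq> {1..e x}"
        by (auto simp: e_def intro: Max_ge)
      then show "card {j \<in> {1..K}. l \<in> A x j} \<le> e x"
        using card_mono[of "{1..e x}"] by fastforce
    qed
    define U where "U = (\<lambda>(s, p). l * s + p) ` (S m \<times> (P \<inter> S (Suc m)))"
    have "U \<subseteq> S (Suc m) \<inter> (\<Inter>x\<in>X. J x (e x))"
    proof
      fix u assume "u \<in> U"
      then obtain s p where u: "u = l * s + p" "s \<in> S m" "p \<in> P" "p \<in> S (Suc m)"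
        by (auto simp: U_def)
      have "l * s \<in> S (Suc m)"
        using hom_space_mult[OF l(1) u(2)] by simp
      then have "u \<in> S (Suc m)"
        using u mp.subspace_add[OF subspace_hom_space] by blast
      moreover have "u \<in> J x (e x)" if x: "x \<in> X" for x
      proof -
        note Jx = JA[OF x e(1)[OF x]]
        have "p \<in> J x (e x)"
          using Jx u rational_point.P_Q[OF points[OF x]] by blast
        moreover have "l * s \<in> J x (e x)"
          using Jx u(2) e(2)[OF x] by blast
        ultimately show ?thesis
          using Jx u(1) mp.subspace_add by blast
      qed
      ultimately show "u \<in> S (Suc m) \<inter> (\<Inter>x\<in>X. J x (e x))"
        by blast
    qed
    then have U_le: "card U \<le> card (S (Suc m) \<inter> (\<Inter>x\<in>X. J x (e x)))"
      by (intro card_mono) (auto simp: finite_hom_space)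
    have "hilbert_fn n P (Suc m) = hilbert_fn n P m + d"
      using M[of m] M[of "Suc m"] by (simp add: m_def algebra_simps flip: of_nat_add of_nat_mult)
    then have U: "card (S (Suc m)) = CARD('a) ^ d * card U"
      unfolding U_def card_hyperplane_section[OF l refl] card_hom_space_eq[of "Suc m"]
      by (simp add: power_add)
    have "card (S (Suc m)) = CARD('a) ^ (\<Sum>x\<in>X. e x) * card (S (Suc m) \<inter> (\<Inter>x\<in>X. J x (e x)))"
    proof (rule card_Inter_contact[where K = K])
      fix x assume x: "x \<in> X"
      note Jx = JA[OF x e(1)[OF x]]
      show "rational_point.Q n P x (Suc K) \<inter> S (Suc m) \<subseteq> J x (e x)"
        using Jx rational_point.Q_antimono[OF points[OF x], of "Suc (e x)" "Suc K"] e(1)[OF x] by auto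
      show "mp.subspace (J x (e x))" "J x (e x) \<subseteq> S (Suc m)" "card (S (Suc m)) = CARD('a) ^ e x * card (J x (e x))"
        using Jx by auto
    qed (auto simp: m_def)
    with U U_le have "CARD('a) ^ (\<Sum>x\<in>X. e x) * card U \<le> CARD('a) ^ d * card U"
      by (metis mult_le_mono2)
    moreover have "card U > 0"
      using U mp.subspace_0[OF subspace_hom_space[of n "Suc m"]] finite_hom_space[of n "Suc m"]
      by (metis card_gt_0_iff empty_iff mult_0_right not_gr_zero)
    ultimately have "(\<Sum>x\<in>X. e x) \<le> d"
      using field_card_ge_2[where 'a = 'a] by simp
    moreover have "(\<Sum>x\<in>X. card {j \<in> {1..K}. l \<in> A x j}) \<le> (\<Sum>x\<in>X. e x)"
      using e(3) by (rule sum_mono)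
    ultimately show ?thesis
      by linarith
  qed
  with JA show thesis
    by (intro that[of A]) auto
qed

end

subsection \<open>Averaging over all hyperplanes\<close>

lemma sum_inverse_powers:
  fixes q :: real
  assumes "q > 1"
  shows "(\<Sum>j=1..K. 1 / q ^ j) = (1 - 1 / q ^ K) / (q - 1)"
  using assms by (induction K) (auto simp: divide_simps, auto simp: algebra_simps)

context curve_points
begin

text \<open>Double counting of triples of a point \<open>x\<close>, an order \<open>j\<close> and a
  linear form \<open>l\<close> in \<open>A x j\<close> outside \<open>P\<close>: each pair of
  \<open>x\<close> and \<open>j\<close> has at least the stated number of forms, and each form
  occurs at most \<open>d\<close> times.\<close>

lemma averaged_contact_bound:
  "real (card X) * (\<Sum>j=1..K. real (card (S 1)) / real CARD('a) ^ j - real (card (P \<inter> S 1)))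
    \<le> real (card (S 1)) * real d"
proof -
  obtain A where A: "\<And>x j. x \<in> X \<Longrightarrow> j \<le> K \<Longrightarrow> A x j \<subseteq> S 1 \<and> P \<inter> S 1 \<subseteq> A x j \<and>
      card (S 1) \<le> CARD('a) ^ j * card (A x j)"
    and sum_le: "\<And>l. l \<in> S 1 \<Longrightarrow> l \<notin> P \<Longrightarrow> (\<Sum>x\<in>X. card {j \<in> {1..K}. l \<in> A x j}) \<le> d"
    using contact_count[of K] by blast
  let ?H = "S 1 - P"
  have fin: "finite ?H"
    by (simp add: finite_hom_space)
  have swap: "(\<Sum>l\<in>?H. card {j \<in> {1..K}. l \<in> A x j}) = (\<Sum>j=1..K. card {l \<in> ?H. l \<in> A x j})" for x
    by (rule sum_multicount_gen[OF fin finite_atLeastAtMost, rotated])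
      (auto intro: arg_cong[where f = card])
  have lower: "real (card (S 1)) / real CARD('a) ^ j - real (card (P \<inter> S 1)) \<le> real (card {l \<in> ?H. l \<in> A x j})"
    if "x \<in> X" "j \<in> {1..K}" for x j
  proof -
    have A': "A x j \<subseteq> S 1" "P \<inter> S 1 \<subseteq> A x j" "card (S 1) \<le> CARD('a) ^ j * card (A x j)"
      using A[of x j] that by auto
    have finA: "finite (A x j)"
      using A'(1) finite_hom_space by (rule finite_subset)
    have "{l \<in> ?H. l \<in> A x j} = A x j - P \<inter> S 1"
      using A'(1) by blast
    then have "card {l \<in> ?H. l \<in> A x j} = card (A x j) - card (P \<inter> S 1)"
      using A'(2) finA by (simp add: card_Diff_subset finite_subset)
    moreover have "card (P \<inter> S 1) \<le> card (A x j)"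
      using finA A'(2) by (rule card_mono)
    moreover have "real (card (S 1)) \<le> real CARD('a) ^ j * real (card (A x j))"
      using A'(3) by (metis of_nat_le_iff of_nat_mult of_nat_power)
    then have "real (card (S 1)) / real CARD('a) ^ j \<le> real (card (A x j))"
      by (simp add: divide_le_eq mult.commute)
    ultimately show ?thesis
      by simp
  qed
  have "real (card X) * (\<Sum>j=1..K. real (card (S 1)) / real CARD('a) ^ j - real (card (P \<inter> S 1)))
      = (\<Sum>x\<in>X. \<Sum>j=1..K. real (card (S 1)) / real CARD('a) ^ j - real (card (P \<inter> S 1)))"
    by simp
  also have "\<dots> \<le> (\<Sum>x\<in>X. \<Sum>j=1..K. real (card {l \<in> ?H. l \<in> A x j}))"
    using lower by (intro sum_mono) auto
  also have "\<dots> = real (\<Sum>x\<in>X. \<Sum>l\<in>?H. card {j \<in> {1..K}. l \<in> A x j})"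
    by (simp only: swap of_nat_sum)
  also have "\<dots> = real (\<Sum>l\<in>?H. \<Sum>x\<in>X. card {j \<in> {1..K}. l \<in> A x j})"
    by (subst sum.swap) simp
  also have "\<dots> \<le> real (\<Sum>l\<in>?H. d)"
    using sum_le by (intro of_nat_mono sum_mono) auto
  also have "\<dots> \<le> real (card (S 1)) * real d"
    using card_mono[OF finite_hom_space[of n 1], of ?H] by (simp add: mult_right_mono)
  finally show ?thesis .
qed

text \<open>Linear forms separate the representing vectors, and those in \<open>P\<close> vanish at
  all of them, so the values on a complement of \<open>P \<inter> S 1\<close> determine the vector.
  This later absorbs the error from the linear forms that vanish on the curve.\<close>

lemma card_points_le_index:
  "card X * card (P \<inter> S 1) \<le> card (S 1)"
proof -
  obtain B where B: "B \<subseteq> P \<inter> S 1" "mp.independent B" "P \<inter> S 1 \<subseteq> mp.span B"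
    using mp.maximal_independent_subset[of "P \<inter> S 1"] by blast
  obtain D where D: "B \<subseteq> D" "D \<subseteq> S 1" "mp.independent D" "S 1 \<subseteq> mp.span D"
    using mp.maximal_independent_subset_extend[of B "S 1"] B by blast
  have finD: "finite D" and finB: "finite B"
    using finite_subset[OF D(2) finite_hom_space] finite_subset[OF D(1)] by auto
  have spanB: "mp.span B = P \<inter> S 1"
    using B mp.span_minimal[OF B(1) subspace_P_hom] by blast
  have spanD: "mp.span D = S 1"
    using D mp.span_minimal[OF D(2) subspace_hom_space] by blast
  define ev where "ev x = restrict (\<lambda>f. mpoly_eval f x) (D - B)" for x :: "nat \<Rightarrow> 'a"
  have "inj_on ev X"
  proof (rule inj_onI)
    fix x y assume xy: "x \<in> X" "y \<in> X" and eq: "ev x = ev y"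
    have "mpoly_eval f x = mpoly_eval f y" if "f \<in> D" for f
    proof (cases "f \<in> B")
      case True
      then show ?thesis
        using B(1) rational_point.vanish[OF points] xy by auto
    next
      case False
      then show ?thesis
        using fun_cong[OF eq, of f] that by (simp add: ev_def)
    qed
    moreover have "mp.subspace {f. mpoly_eval f x = mpoly_eval f y}"
      by (rule mp.subspaceI) (auto simp: mpoly_eval_add)
    ultimately have "mp.span D \<subseteq> {f. mpoly_eval f x = mpoly_eval f y}"
      by (intro mp.span_minimal) auto
    then have "x i = y i" if "i \<le> n" for i
      using var_in_hom_space[OF that] spanD by force
    moreover have "x i = y i" if "\<not> i \<le> n" for i
      using supported[OF xy(1)] supported[OF xy(2)] that by simp
    ultimately show "x = y"
      by blast
  qed
  then have "card X \<le> card ((D - B) \<rightarrow>\<^sub>E (UNIV :: 'a set))"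
    using finD by (intro card_inj_on_le[of ev]) (auto simp: ev_def intro!: finite_PiE split: if_splits)
  also have "\<dots> = CARD('a) ^ (card D - card B)"
    using finD finB D(1) by (simp add: card_PiE card_Diff_subset)
  finally have "card X * card (P \<inter> S 1) \<le> CARD('a) ^ (card D - card B) * CARD('a) ^ card B"
    using mp.card_span_independent[OF finite finB B(2)] by (simp add: spanB)
  also have "\<dots> = CARD('a) ^ card D"
    using card_mono[OF finD D(1)] by (simp flip: power_add)
  also have "\<dots> = card (S 1)"
    using mp.card_span_independent[OF finite finD D(3)] by (simp add: spanD)
  finally show ?thesis .
qed

text \<open>The geometric sum gives the main term. The subtracted terms add up to
  \<open>K * card X * card (P \<inter> S 1)\<close>, at most \<open>K * card (S 1)\<close>, so they
  cost only the summand \<open>K\<close>.\<close>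

lemma card_points_bound:
  "(1 - 1 / real CARD('a) ^ K) * real (card X) \<le> (real CARD('a) - 1) * (real d + real K)"
proof -
  let ?q = "real CARD('a)" and ?s = "real (card (S 1))" and ?p = "real (card (P \<inter> S 1))" and ?N = "real (card X)"
  have q: "?q > 1"
    using field_card_ge_2[where 'a = 'a] by simp
  have s: "?s > 0"
    using finite_hom_space[of n 1] mp.subspace_0[OF subspace_hom_space] by (auto simp: card_gt_0_iff)
  have "(\<Sum>j=1..K. ?s / ?q ^ j - ?p) = ?s * (\<Sum>j=1..K. 1 / ?q ^ j) - real K * ?p"
    by (simp add: sum_subtractf sum_distrib_left)
  then have "?N * (?s * ((1 - 1 / ?q ^ K) / (?q - 1)) - real K * ?p) \<le> ?s * real d"
    using averaged_contact_bound[of K] by (simp only: sum_inverse_powers[OF q])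
  moreover have "?N * ?p \<le> ?s"
    using card_points_le_index by (metis of_nat_le_iff of_nat_mult)
  then have "real K * (?N * ?p) \<le> real K * ?s"
    by (rule mult_left_mono) simp
  ultimately have "?s * (?N * ((1 - 1 / ?q ^ K) / (?q - 1))) \<le> ?s * (real d + real K)"
    by (simp add: algebra_simps)
  then have "?N * ((1 - 1 / ?q ^ K) / (?q - 1)) \<le> real d + real K"
    using s by (rule mult_left_le_imp_le)
  then show ?thesis
    using q by (simp add: divide_le_eq mult.commute)
qed

end

section \<open>From representing vectors to projective points\<close>

lemma nonproportional_separated:
  fixes x y :: "nat \<Rightarrow> 'a::field"
  assumes "\<And>i. i > n \<Longrightarrow> x i = 0" "\<And>i. i > n \<Longrightarrow> y i = 0" "x \<noteq> (\<lambda>_. 0)" "y \<noteq> (\<lambda>_. 0)"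
    and "{(\<lambda>i. c * x i) | c. c \<noteq> 0} \<noteq> {(\<lambda>i. c * y i) | c. c \<noteq> 0}"
  shows "\<exists>l\<in>hom_space n 1. mpoly_eval l y = 0 \<and> mpoly_eval l x \<noteq> 0"
proof -
  obtain i where i: "y i \<noteq> 0"
    using assms(4) by blast
  then have "i \<le> n"
    using assms(2) not_le by blast
  \<comment> \<open>If all these minors vanished, \<open>x\<close> would be \<open>x i / y i\<close>
    times \<open>y\<close>, and both vectors would represent the same point.\<close>
  have "\<exists>j\<le>n. y i * x j \<noteq> y j * x i"
  proof (rule ccontr)
    assume "\<not> ?thesis"
    then have eq: "y i * x j = y j * x i" for j
      using assms(1,2) by (cases "j \<le> n") auto
    define k where "k = x i / y i"
    have x: "x = (\<lambda>j. k * y j)"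
      using eq i by (auto simp: k_def field_simps)
    with assms(3) have k: "k \<noteq> 0"
      by auto
    have "{(\<lambda>i. c * x i) | c. c \<noteq> 0} = {(\<lambda>i. c * y i) | c. c \<noteq> 0}"
    proof (intro equalityI subsetI)
      fix f assume "f \<in> {(\<lambda>i. c * x i) | c. c \<noteq> 0}"
      then obtain c where "c \<noteq> 0" "f = (\<lambda>i. c * x i)" by blast
      then show "f \<in> {(\<lambda>i. c * y i) | c. c \<noteq> 0}"
        using k by (intro CollectI exI[of _ "c * k"]) (simp add: x mult.assoc)
    next
      fix f assume "f \<in> {(\<lambda>i. c * y i) | c. c \<noteq> 0}"
      then obtain c where "c \<noteq> 0" "f = (\<lambda>i. c * y i)" by blast
      then show "f \<in> {(\<lambda>i. c * x i) | c. c \<noteq> 0}"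
        using k by (intro CollectI exI[of _ "c / k"]) (simp add: x)
    qed
    with assms(5) show False ..
  qed
  then obtain j where j: "j \<le> n" "y i * x j \<noteq> y j * x i"
    by blast
  \<comment> \<open>The nonzero minor, with the coordinates of \<open>x\<close> replaced by
    variables.\<close>
  define l where "l = smult_mp (y i) (var j) - smult_mp (y j) (var i)"
  have "l \<in> hom_space n 1"
    unfolding l_def using \<open>i \<le> n\<close> j(1) by (intro hom_space_diff hom_space_smult var_in_hom_space)
  moreover have "mpoly_eval l y = 0" "mpoly_eval l x \<noteq> 0"
    using j(2) by (simp_all add: l_def mpoly_eval_diff mult.commute)
  ultimately show ?thesis
    by blast
qed

lemma card_rational_points_bound:
  fixes P :: "'a::{finite,field} mpoly set"
  assumes "proj_curve_deg n P d"
  shows "(1 - 1 / real CARD('a) ^ K) * real (card (rational_points n P)) \<le> (real CARD('a) - 1) * (real d + real K)"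
proof -
  define Z where "Z = {x :: nat \<Rightarrow> 'a. (\<forall>i>n. x i = 0) \<and> x \<noteq> (\<lambda>_. 0) \<and> (\<forall>f\<in>P. mpoly_eval f x = 0)}"
  define cls where "cls x = {(\<lambda>i. c * x i) | c. c \<noteq> (0::'a)}" for x :: "nat \<Rightarrow> 'a"
  have "finite {x :: nat \<Rightarrow> 'a. \<forall>i. (i \<in> {..n} \<longrightarrow> x i \<in> UNIV) \<and> (i \<notin> {..n} \<longrightarrow> x i = 0)}"
    by (rule finite_set_of_finite_funs) auto
  then have "finite Z"
    by (rule rev_finite_subset) (auto simp: Z_def)
  have rp: "rational_points n P = cls ` Z"
    by (auto simp: rational_points_def Z_def cls_def)
  \<comment> \<open>One representing vector is chosen per rational point, so counting vectors counts
    points.\<close>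
  obtain X where X: "X \<subseteq> Z" "inj_on cls X" "rational_points n P = cls ` X"
    using subset_image_inj[of "cls ` Z" cls Z] rp by auto
  \<comment> \<open>A nonzero coordinate of \<open>x\<close>, divided by its value, is the
    normalised form.\<close>
  define T where "T x = (let i = SOME i. x i \<noteq> 0 in smult_mp (inverse (x i)) (var i))" for x :: "nat \<Rightarrow> 'a"
  have T: "T x \<in> hom_space n 1 \<and> mpoly_eval (T x) x = 1" if "x \<in> X" for x
  proof -
    have "x \<noteq> (\<lambda>_. 0)" "\<forall>i>n. x i = 0"
      using that X(1) by (auto simp: Z_def)
    then have "\<exists>i. x i \<noteq> 0"
      by blast
    then have i: "x (SOME i. x i \<noteq> 0) \<noteq> 0"
      by (rule someI_ex)
    then have "(SOME i. x i \<noteq> 0) \<le> n"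
      using \<open>\<forall>i>n. x i = 0\<close> not_le by blast
    then show ?thesis
      unfolding T_def Let_def using i var_in_hom_space by (auto intro: hom_space_smult)
  qed
  interpret homog_prime n P
    using assms by unfold_locales (simp add: proj_curve_deg_def)
  interpret curve_points n P d X T
  proof
    show "\<exists>l\<in>hom_space n 1. mpoly_eval l y = 0 \<and> mpoly_eval l x \<noteq> 0" if "x \<in> X" "y \<in> X" "x \<noteq> y" for x y
      using that X(1,2) unfolding inj_on_def cls_def
      by (intro nonproportional_separated) (auto simp: Z_def)
  qed (use assms T X(1) \<open>finite Z\<close> finite_subset in \<open>auto simp: Z_def rational_point_def rational_point_axioms_def homog_prime_axioms\<close>)
  have "card (rational_points n P) = card X"
    using X by (simp add: card_image)
  moreover have "(1 - 1 / real CARD('a) ^ K) * real (card X) \<le> (real CARD('a) - 1) * (real d + real K)"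
    by (rule card_points_bound)
  ultimately show ?thesis
    by simp
qed

section \<open>Limits in the degree and in the truncation\<close>

lemma homma_const_le:
  assumes "K > 0"
  shows "homma_const TYPE('a::{finite,field}) \<le> ereal ((real CARD('a) - 1) / (1 - 1 / real CARD('a) ^ K))"
proof -
  let ?q = "real CARD('a)"
  define r where "r = (?q - 1) / (1 - 1 / ?q ^ K)"
  have q: "?q > 1"
    using field_card_ge_2[where 'a = 'a] by simp
  have pos: "1 - 1 / ?q ^ K > 0"
    using q assms by simp
  \<comment> \<open>For fixed \<open>K\<close> the additive error turns into \<open>K / d\<close>,
    which tends to 0. The degree \<open>d = 0\<close> is left out for the division, and the limsup
    does not see it.\<close>
  have *: "max_points TYPE('a) d / ereal (real d) \<le> ereal (r * (1 + real K / real d))" if d: "d > 0" for d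
  proof -
    have "max_points TYPE('a) d \<le> ereal (r * (real d + real K))"
      unfolding max_points_def
    proof (rule SUP_least, clarsimp)
      fix n and P :: "'a mpoly set" assume "proj_curve_deg n P d"
      then show "real (card (rational_points n P)) \<le> r * (real d + real K)"
        using card_rational_points_bound[of n P d K] pos
        by (simp add: r_def pos_le_divide_eq mult.commute)
    qed
    then have "max_points TYPE('a) d / ereal (real d) \<le> ereal (r * (real d + real K)) / ereal (real d)"
      using d by (intro ereal_divide_right_mono) auto
    also have "\<dots> = ereal (r * (1 + real K / real d))"
      using d by (simp add: field_simps)
    finally show ?thesis .
  qed
  have "homma_const TYPE('a) \<le> limsup (\<lambda>d. ereal (r * (1 + real K / real d)))"
    unfolding homma_const_def
    by (intro Limsup_mono eventually_mono[OF eventually_gt_at_top[of 0] *])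
  also have "(\<lambda>d. ereal (r * (1 + real K / real d))) \<longlonglongrightarrow> ereal (r * (1 + 0))"
    by (intro tendsto_intros lim_const_over_n)
  then have "limsup (\<lambda>d. ereal (r * (1 + real K / real d))) = ereal (r * (1 + 0))"
    by (intro lim_imp_Limsup) auto
  finally show ?thesis
    by (simp add: r_def)
qed

theorem theorem1p1:
  shows "homma_const TYPE('a::{finite,field}) \<le> ereal (real CARD('a) - 1)"
proof (rule LIMSEQ_le_const)
  let ?q = "real CARD('a)"
  have q: "?q > 1"
    using field_card_ge_2[where 'a = 'a] by simp
  have "(\<lambda>K. 1 / ?q ^ K) \<longlonglongrightarrow> 0"
    using LIMSEQ_inverse_realpow_zero[OF q] by (simp add: inverse_eq_divide)
  then have "(\<lambda>K. ereal ((?q - 1) / (1 - 1 / ?q ^ K))) \<longlonglongrightarrow> ereal ((?q - 1) / (1 - 0))"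
    by (intro tendsto_intros) auto
  then show "(\<lambda>K. ereal ((?q - 1) / (1 - 1 / ?q ^ K))) \<longlonglongrightarrow> ereal (?q - 1)"
    by simp
  \<comment> \<open>The bound is used from \<open>K = 1\<close> on, since the denominator is 0 at
    \<open>K = 0\<close>.\<close>
  show "\<exists>N. \<forall>K\<ge>N. homma_const TYPE('a) \<le> ereal ((?q - 1) / (1 - 1 / ?q ^ K))"
    using homma_const_le[where 'a = 'a] by (intro exI[of _ 1]) auto
qed

end
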